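(* Let $\{\mathbf{h}_1,\dots,\mathbf{h}_N\}$ be a minimal generating set of $\mathbf{Cov}(S_{2n})$ consisting of homogeneous covariants. Then $\{\varsigma(\mathbf{h}_1),\dots,\varsigma(\mathbf{h}_N),\Delta\}$ is a minimal generating set of the invariant algebra $\mathbb{C}[S_{2n}\oplus S_2]^{SL(2,\mathbb{C})}$, where $\Delta(\mathbf{w})=b_1^2-b_0b_2$ for $\mathbf{w}=b_0u^2+b_1uv+b_2v^2\in S_2$.
   Context: $S_m$ is the complex vector space of binary forms of degree $m$, i.e. homogeneous polynomials of degree $m$ in $\xi=(u,v)\in\mathbb{C}^2$, with $SL(2,\mathbb{C})$-action $(\gamma\star\mathbf{f})(\xi)=\mathbf{f}(\gamma^{-1}\xi)$. For $\mathbf{f}\in S_m$, $\mathbf{g}\in S_p$ the transvectant of index $r$ is $\{\mathbf{f},\mathbf{g}\}_r=\frac{(m-r)!}{m!}\frac{(p-r)!}{p!}\sum_{i=0}^r(-1)^i\binom{r}{i}\frac{\partial^r\mathbf{f}}{\partial u^{r-i}\partial v^{i}}\frac{\partial^r\mathbf{g}}{\partial u^{i}\partial v^{r-i}}\in S_{m+p-2r}$. $\mathbf{Cov}(S_{2n})=\mathbb{C}[S_{2n}\oplus\mathbb{C}^2]^{SL(2,\mathbb{C})}$ (polynomials $\mathbf{h}(\mathbf{f},\xi)$ invariant under the diagonal action); the order of a covariant is its degree in $\xi$; every covariant decomposes as $\mathbf{h}=\sum_{k=0}^{r}\mathbf{h}_{2k}$ with $\mathbf{h}_{2k}$ homogeneous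 of order $2k$ (only even orders occur). The linear map $\varsigma:\mathbf{Cov}(S_{2n})\to\mathbb{C}[S_{2n}\oplus S_2]^{SL(2,\mathbb{C})}$ is $\varsigma(\mathbf{h})(\mathbf{f},\mathbf{w})=\sum_{k=0}^r\{\mathbf{h}_{2k}(\mathbf{f},\cdot),\mathbf{w}^k\}_{2k}$, where $\mathbf{h}_{2k}(\mathbf{f},\cdot)$ is viewed as a binary form in $\xi$. A generating set is minimal if no proper subset generates.
   Formalization: The discriminant b_1^2−b_0b_2 is taken for w=b_0u^2+2b_1uv+b_2v^2 (with b_1uv as printed it is not SL(2,C)-invariant); "homogeneous covariant" is read as homogeneous both in the coefficients of f and in ξ. *)

theory Defs
  imports "HOL-Analysis.Analysis"
begin

text \<open>The complex algebra of functions generated by a set G of complex-valued functions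
  (closure of G and the constants under pointwise sum and product).  Polynomial functions
  in given coordinates are the algebra generated by these coordinate functions.\<close>

inductive_set alg_gen :: "('x \<Rightarrow> complex) set \<Rightarrow> ('x \<Rightarrow> complex) set" for G where
  gen:   "g \<in> G \<Longrightarrow> g \<in> alg_gen G"
| const: "(\<lambda>_. c) \<in> alg_gen G"
| add:   "p \<in> alg_gen G \<Longrightarrow> q \<in> alg_gen G \<Longrightarrow> (\<lambda>x. p x + q x) \<in> alg_gen G"
| mult:  "p \<in> alg_gen G \<Longrightarrow> q \<in> alg_gen G \<Longrightarrow> (\<lambda>x. p x * q x) \<in> alg_gen G"

definition min_gen :: "('x \<Rightarrow> complex) set \<Rightarrow> ('x \<Rightarrow> complex) set \<Rightarrow> bool" where
  "min_gen A G \<longleftrightarrow> alg_gen G = A \<and> (\<forall>G'. G' \<subset> G \<longrightarrow> alg_gen G' \<noteq> A)"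

definition bf :: "nat \<Rightarrow> (nat \<Rightarrow> complex) \<Rightarrow> complex \<times> complex \<Rightarrow> complex" where
  "bf m a = (\<lambda>(u,v). \<Sum>i\<le>m. of_nat (m choose i) * a i * u ^ (m - i) * v ^ i)"

text \<open>SL(2,C): gamma = (p,q,r,s) is the matrix [[p,q],[r,s]] with ps - qr = 1.\<close>
definition sl2 :: "(complex \<times> complex \<times> complex \<times> complex) set" where
  "sl2 = {(p,q,r,s). p * s - q * r = 1}"

definition gmap :: "complex \<times> complex \<times> complex \<times> complex \<Rightarrow> complex \<times> complex \<Rightarrow> complex \<times> complex" where
  "gmap g = (case g of (p,q,r,s) \<Rightarrow> (\<lambda>(u,v). (p * u + q * v, r * u + s * v)))"

definition ginv :: "complex \<times> complex \<times> complex \<times> complex \<Rightarrow> complex \<times> complex \<Rightarrow> complex \<times> complex" where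
  "ginv g = (case g of (p,q,r,s) \<Rightarrow> (\<lambda>(u,v). (s * u - q * v, - r * u + p * v)))"

definition act :: "nat \<Rightarrow> complex \<times> complex \<times> complex \<times> complex \<Rightarrow> (nat \<Rightarrow> complex) \<Rightarrow> (nat \<Rightarrow> complex)" where
  "act m g a = (THE c. (\<forall>i>m. c i = 0) \<and> (\<forall>\<xi>. bf m c \<xi> = bf m a (ginv g \<xi>)))"

definition cov_coords :: "nat \<Rightarrow> ((nat \<Rightarrow> complex) \<times> (complex \<times> complex) \<Rightarrow> complex) set" where
  "cov_coords n = {(\<lambda>x. fst x i) | i. i \<le> 2 * n} \<union> {(\<lambda>x. fst (snd x)), (\<lambda>x. snd (snd x))}"

definition Cov :: "nat \<Rightarrow> ((nat \<Rightarrow> complex) \<times> (complex \<times> complex) \<Rightarrow> complex) set" where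
  "Cov n = {h \<in> alg_gen (cov_coords n).
     \<forall>g\<in>sl2. \<forall>a \<xi>. h (act (2 * n) g a, gmap g \<xi>) = h (a, \<xi>)}"

definition inv_coords :: "nat \<Rightarrow> ((nat \<Rightarrow> complex) \<times> (nat \<Rightarrow> complex) \<Rightarrow> complex) set" where
  "inv_coords n = {(\<lambda>x. fst x i) | i. i \<le> 2 * n} \<union> {(\<lambda>x. snd x j) | j. j \<le> 2}"

definition Inv2 :: "nat \<Rightarrow> ((nat \<Rightarrow> complex) \<times> (nat \<Rightarrow> complex) \<Rightarrow> complex) set" where
  "Inv2 n = {F \<in> alg_gen (inv_coords n).
     \<forall>g\<in>sl2. \<forall>a b. F (act (2 * n) g a, act 2 g b) = F (a, b)}"

definition homog_cov :: "((nat \<Rightarrow> complex) \<times> (complex \<times> complex) \<Rightarrow> complex) \<Rightarrow> bool" where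
  "homog_cov h \<longleftrightarrow> (\<exists>d k. \<forall>t s a u v.
      h (\<lambda>i. t * a i, (s * u, s * v)) = t ^ d * s ^ k * h (a, (u, v)))"

text \<open>Homogeneous component of order j in xi: coefficient of s^j in h(f, s xi).\<close>
definition comp :: "nat \<Rightarrow> ((nat \<Rightarrow> complex) \<times> (complex \<times> complex) \<Rightarrow> complex)
    \<Rightarrow> (nat \<Rightarrow> complex) \<times> (complex \<times> complex) \<Rightarrow> complex" where
  "comp j h = (\<lambda>(a, (u, v)). (deriv ^^ j) (\<lambda>s. h (a, (s * u, s * v))) 0 / fact j)"

definition pu :: "(complex \<times> complex \<Rightarrow> complex) \<Rightarrow> complex \<times> complex \<Rightarrow> complex" where
  "pu F = (\<lambda>(u, v). deriv (\<lambda>t. F (t, v)) u)"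

definition pv :: "(complex \<times> complex \<Rightarrow> complex) \<Rightarrow> complex \<times> complex \<Rightarrow> complex" where
  "pv F = (\<lambda>(u, v). deriv (\<lambda>t. F (u, t)) v)"

definition transv :: "nat \<Rightarrow> nat \<Rightarrow> nat \<Rightarrow> (complex \<times> complex \<Rightarrow> complex)
    \<Rightarrow> (complex \<times> complex \<Rightarrow> complex) \<Rightarrow> complex \<times> complex \<Rightarrow> complex" where
  "transv m p r F G = (\<lambda>\<xi>. (fact (m - r) / fact m) * (fact (p - r) / fact p) *
     (\<Sum>i\<le>r. (-1) ^ i * of_nat (r choose i) *
        ((pu ^^ (r - i)) ((pv ^^ i) F)) \<xi> * ((pu ^^ i) ((pv ^^ (r - i)) G)) \<xi>))"

text \<open>The map varsigma: sum over k of {h_{2k}(f,.), w^k}_{2k}; the result lies in S_0 = C,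
  i.e. is a constant binary form, which we evaluate (at xi = 0).  Only finitely many
  components of a polynomial covariant are nonzero.\<close>
definition varsigma :: "((nat \<Rightarrow> complex) \<times> (complex \<times> complex) \<Rightarrow> complex)
    \<Rightarrow> (nat \<Rightarrow> complex) \<times> (nat \<Rightarrow> complex) \<Rightarrow> complex" where
  "varsigma h = (\<lambda>(a, b). \<Sum>k\<in>{k. comp (2 * k) h \<noteq> (\<lambda>_. 0)}.
      transv (2 * k) (2 * k) (2 * k) (\<lambda>\<xi>. comp (2 * k) h (a, \<xi>)) (\<lambda>\<xi>. (bf 2 b \<xi>) ^ k) (0, 0))"

text \<open>Delta(w) = b_1^2 - b_0 b_2 for w = b_0 u^2 + 2 b_1 u v + b_2 v^2.\<close>
definition Delta :: "(nat \<Rightarrow> complex) \<times> (nat \<Rightarrow> complex) \<Rightarrow> complex" where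
  "Delta = (\<lambda>(a, b). (b 1) ^ 2 - b 0 * b 2)"

end

theory Submission
  imports Defs
begin

text \<open>Evaluating an invariant \<open>F(f, w)\<close> at the square \<open>w = (v x - u y)\<^sup>2\<close> of the linear form vanishing at
  \<open>\<xi> = (u, v)\<close> is an algebra homomorphism \<open>\<rho>\<close> from joint invariants to covariants, and
  \<open>\<rho> (varsigma h) = h\<close>. A binary quadratic form is such a square iff \<open>Delta\<close> vanishes, and \<open>Delta\<close> is
  monic in \<open>b\<^sub>1\<close>, so the kernel of \<open>\<rho>\<close> is the ideal generated by \<open>Delta\<close>. Generation follows by
  induction on the degree in \<open>w\<close>. For minimality, \<open>\<rho>\<close> turns a smaller generating set containing \<open>Delta\<close>
  into a smaller generating set of covariants, and \<open>Delta\<close> itself is indispensable because every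
  generator \<open>varsigma h\<close> vanishes at \<open>f = 0\<close>: a covariant of degree 0 in \<open>f\<close> is constant.\<close>

section \<open>Generated algebras of functions\<close>

lemma alg_gen_sum:
  assumes "\<And>i. i \<in> I \<Longrightarrow> f i \<in> alg_gen G"
  shows "(\<lambda>x. \<Sum>i\<in>I. f i x) \<in> alg_gen G"
  using assms
  by (induction I rule: infinite_finite_induct) (auto intro: alg_gen.intros)

lemma alg_gen_power:
  assumes "f \<in> alg_gen G"
  shows "(\<lambda>x. f x ^ k) \<in> alg_gen G"
  using assms by (induction k) (auto intro: alg_gen.intros)

lemma alg_gen_cmult:
  assumes "f \<in> alg_gen G"
  shows "(\<lambda>x. c * f x) \<in> alg_gen G"
  using assms by (intro alg_gen.mult alg_gen.const)

lemma alg_gen_diff: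
  assumes "f \<in> alg_gen G" "g \<in> alg_gen G"
  shows "(\<lambda>x. f x - g x) \<in> alg_gen G"
  using alg_gen.add[OF assms(1) alg_gen_cmult[OF assms(2), of "-1"]] by simp

lemma alg_gen_compose:
  assumes "p \<in> alg_gen G" "\<And>g. g \<in> G \<Longrightarrow> (\<lambda>x. g (f x)) \<in> alg_gen G'"
  shows "(\<lambda>x. p (f x)) \<in> alg_gen G'"
  using assms(1) by induction (auto intro: alg_gen.intros assms(2))

lemma alg_gen_least:
  assumes "G \<subseteq> alg_gen G'"
  shows "alg_gen G \<subseteq> alg_gen G'"
  using alg_gen_compose[of _ G "\<lambda>x. x" G'] assms by auto

lemma alg_gen_insert_const: "alg_gen (insert (\<lambda>_. c) G) = alg_gen G"
proof
  show "alg_gen (insert (\<lambda>_. c) G) \<subseteq> alg_gen G"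
    by (rule alg_gen_least) (auto intro: alg_gen.intros)
  show "alg_gen G \<subseteq> alg_gen (insert (\<lambda>_. c) G)"
    by (rule alg_gen_least) (auto intro: alg_gen.gen)
qed

text \<open>Induction on generation; at a product the components are the Cauchy product of the two
  families. The scaling \<open>\<sigma>\<close> stays abstract because three are used: of
  \<open>u\<close>, of \<open>v\<close>, and of the quadratic form.\<close>

lemma alg_gen_graded:
  assumes "p \<in> alg_gen G" and hom: "\<And>g. g \<in> G \<Longrightarrow> \<exists>d. \<forall>t x. g (\<sigma> t x) = t ^ d * g x"
  shows "\<exists>N P. (\<forall>j. P j \<in> alg_gen G \<and> (\<forall>t x. P j (\<sigma> t x) = t ^ j * P j x)) \<and>
    (\<forall>j>N. P j = (\<lambda>_. 0)) \<and> (\<forall>x. p x = (\<Sum>j\<le>N. P j x))"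
  using assms(1)
proof induction
  case (gen g)
  then obtain d where d: "\<forall>t x. g (\<sigma> t x) = t ^ d * g x" using hom by blast
  have "g x = (\<Sum>j\<le>d. (if j = d then g else (\<lambda>_. 0)) x)" for x
    by (subst if_distribR) simp
  then show ?case
    by (intro exI[of _ d], intro exI[of _ "\<lambda>j. if j = d then g else (\<lambda>_. 0)"])
       (use gen d in \<open>auto intro: alg_gen.intros\<close>)
next
  case (const c)
  show ?case
    by (rule exI[of _ 0], rule exI[of _ "\<lambda>j. if j = 0 then (\<lambda>_. c) else (\<lambda>_. 0)"])
       (auto intro: alg_gen.intros)
next
  case (add p q)
  obtain N P where P: "\<And>j. P j \<in> alg_gen G" "\<And>j t x. P j (\<sigma> t x) = t ^ j * P j x"
    "\<And>j. j > N \<Longrightarrow> P j = (\<lambda>_. 0)" "\<And>x. p x = (\<Sum>j\<le>N. P j x)" using add.IH(1) by blast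
  obtain M Q where Q: "\<And>j. Q j \<in> alg_gen G" "\<And>j t x. Q j (\<sigma> t x) = t ^ j * Q j x"
    "\<And>j. j > M \<Longrightarrow> Q j = (\<lambda>_. 0)" "\<And>x. q x = (\<Sum>j\<le>M. Q j x)" using add.IH(2) by blast
  have "p x = (\<Sum>j\<le>max N M. P j x)" for x
    unfolding P(4) by (rule sum.mono_neutral_left) (auto simp: P(3))
  moreover have "q x = (\<Sum>j\<le>max N M. Q j x)" for x
    unfolding Q(4) by (rule sum.mono_neutral_left) (auto simp: Q(3))
  ultimately show ?case
    by (intro exI[of _ "max N M"] exI[of _ "\<lambda>j x. P j x + Q j x"])
       (auto simp: P Q sum.distrib algebra_simps intro: alg_gen.add)
next
  case (mult p q)
  obtain N P where P: "\<And>j. P j \<in> alg_gen G" "\<And>j t x. P j (\<sigma> t x) = t ^ j * P j x"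
    "\<And>j. j > N \<Longrightarrow> P j = (\<lambda>_. 0)" "\<And>x. p x = (\<Sum>j\<le>N. P j x)" using mult.IH(1) by blast
  obtain M Q where Q: "\<And>j. Q j \<in> alg_gen G" "\<And>j t x. Q j (\<sigma> t x) = t ^ j * Q j x"
    "\<And>j. j > M \<Longrightarrow> Q j = (\<lambda>_. 0)" "\<And>x. q x = (\<Sum>j\<le>M. Q j x)" using mult.IH(2) by blast
  \<comment> \<open>Multiplication of two polynomials, evaluated at 1; the components vanish beyond
    \<open>N\<close> and \<open>M\<close>, as the coefficients must.\<close>
  have "p x * q x = (\<Sum>r\<le>N+M. \<Sum>k\<le>r. P k x * Q (r - k) x)" for x
    using polynomial_product[of N "\<lambda>j. P j x" M "\<lambda>j. Q j x" 1] P(3) Q(3) by (simp add: P(4) Q(4))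
  moreover have "(\<Sum>k\<le>r. P k (\<sigma> t x) * Q (r - k) (\<sigma> t x)) = t ^ r * (\<Sum>k\<le>r. P k x * Q (r - k) x)"
    for r t x
    unfolding sum_distrib_left
    by (rule sum.cong) (auto simp: P(2) Q(2) power_add[symmetric] algebra_simps)
  moreover have "P k x * Q (r - k) x = 0" if "r > N + M" "k \<le> r" for r k x
  proof (cases "k > N")
    case False
    then have "r - k > M" using that by linarith
    then show ?thesis using Q(3) by simp
  qed (use P(3) in simp)
  ultimately show ?case
    by (intro exI[of _ "N + M"] exI[of _ "\<lambda>r x. \<Sum>k\<le>r. P k x * Q (r - k) x"])
       (auto simp: fun_eq_iff intro!: sum.neutral alg_gen_sum alg_gen.mult P(1) Q(1))
qed

text \<open>Both sides are polynomials in \<open>t\<close>, so the coefficients of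
  \<open>t ^ d\<close> agree. Vanishing beyond \<open>N\<close> covers the case
  \<open>d > N\<close>.\<close>

lemma homogeneous_component_eq:
  fixes P :: "nat \<Rightarrow> complex"
  assumes "\<And>t. t ^ d * F = (\<Sum>j\<le>N. t ^ j * P j)" "\<And>j. j > N \<Longrightarrow> P j = 0"
  shows "F = P d"
proof -
  define p where "p = (\<Sum>j\<le>N. monom (P j) j)"
  have "poly (monom F d) t = poly p t" for t
    using assms(1)[of t] by (simp add: p_def poly_sum poly_monom mult.commute)
  then have "monom F d = p" using poly_eq_poly_eq_iff by blast
  then have "F = coeff p d" by (metis coeff_monom)
  also have "\<dots> = P d" using assms(2)[of d] by (auto simp: p_def coeff_sum)
  finally show ?thesis .
qed

section \<open>Binary forms and their coefficients\<close>

lemma bf_Pair: "bf m a (u, v) = (\<Sum>i\<le>m. of_nat (m choose i) * a i * u ^ (m - i) * v ^ i)"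
  by (simp add: bf_def)

lemma bf_cong: "(\<And>i. i \<le> m \<Longrightarrow> c i = d i) \<Longrightarrow> bf m c \<xi> = bf m d \<xi>"
  by (cases \<xi>) (simp add: bf_Pair)

lemma bf_inj:
  assumes "\<And>\<xi>. bf m c \<xi> = bf m d \<xi>" "i \<le> m"
  shows "c i = d i"
proof -
  have "(\<Sum>i\<le>m. (of_nat (m choose i) * c i) * v ^ i) = (\<Sum>i\<le>m. (of_nat (m choose i) * d i) * v ^ i)" for v
    using assms(1)[of "(1, v)"] by (simp add: bf_Pair)
  then have "of_nat (m choose i) * c i = of_nat (m choose i) * d i"
    using assms(2) polyfun_eq_coeffs[of "\<lambda>i. of_nat (m choose i) * c i" m "\<lambda>i. of_nat (m choose i) * d i"] by blast
  then show ?thesis using assms(2) by simp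
qed

lemma bf_add: "bf m (\<lambda>i. a i + b i) \<xi> = bf m a \<xi> + bf m b \<xi>"
  by (cases \<xi>) (simp add: bf_Pair algebra_simps sum.distrib)

lemma bf_scale: "bf m (\<lambda>i. t * a i) \<xi> = t * bf m a \<xi>"
  by (cases \<xi>) (simp add: bf_Pair algebra_simps sum_distrib_left)

lemma bf_homogeneous: "bf m a (s * u, s * v) = s ^ m * bf m a (u, v)"
  unfolding bf_Pair sum_distrib_left
  by (rule sum.cong) (auto simp: power_mult_distrib power_add[symmetric] algebra_simps)

lemma cov_coords_cases:
  assumes "g \<in> cov_coords n"
  obtains i where "i \<le> 2 * n" "g = (\<lambda>x. fst x i)" | "g = (\<lambda>x. fst (snd x))" | "g = (\<lambda>x. snd (snd x))"
  using assms by (auto simp: cov_coords_def)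

lemma cov_coords_intros:
  "i \<le> 2 * n \<Longrightarrow> (\<lambda>x. fst x i) \<in> alg_gen (cov_coords n)"
  "(\<lambda>x. fst (snd x)) \<in> alg_gen (cov_coords n)" "(\<lambda>x. snd (snd x)) \<in> alg_gen (cov_coords n)"
  by (auto simp: cov_coords_def intro: alg_gen.gen)

text \<open>Grading by \<open>u\<close> and then by \<open>v\<close> writes \<open>h\<close> as a
  sum of monomials with coefficients polynomial in \<open>a\<close>; homogeneity leaves only those
  of total degree \<open>m\<close>. This turns functions into coefficient vectors.\<close>

lemma ex_bf_coefficients:
  assumes h: "h \<in> alg_gen (cov_coords n)"
    and hom: "\<And>s a u v. h (a, (s * u, s * v)) = s ^ m * h (a, (u, v))"
  shows "\<exists>c. (\<forall>i. (\<lambda>a. c a i) \<in> alg_gen {\<lambda>a. a i | i. i \<le> 2 * n}) \<and> (\<forall>a \<xi>. h (a, \<xi>) = bf m (c a) \<xi>)"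
proof -
  let ?A = "{\<lambda>a. a i | i. i \<le> 2 * n}"
  let ?\<sigma> = "\<lambda>t (x :: (nat \<Rightarrow> complex) \<times> complex \<times> complex). (fst x, (t * fst (snd x), snd (snd x)))"
  let ?\<tau> = "\<lambda>t (x :: (nat \<Rightarrow> complex) \<times> complex \<times> complex). (fst x, (fst (snd x), t * snd (snd x)))"
  have g\<sigma>: "\<exists>d. \<forall>t x. g (?\<sigma> t x) = t ^ d * g x" if "g \<in> cov_coords n" for g
    using that by (rule cov_coords_cases)
      (auto intro: exI[of _ "0::nat"] exI[of _ "1::nat"])
  have g\<tau>: "\<exists>d. \<forall>t x. g (?\<tau> t x) = t ^ d * g x" if "g \<in> cov_coords n" for g
    using that by (rule cov_coords_cases)
      (auto intro: exI[of _ "0::nat"] exI[of _ "1::nat"])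
  obtain N P where P: "\<And>j. P j \<in> alg_gen (cov_coords n)" "\<And>j t x. P j (?\<sigma> t x) = t ^ j * P j x"
    "\<And>x. h x = (\<Sum>j\<le>N. P j x)" using alg_gen_graded[OF h, of ?\<sigma>, OF g\<sigma>] by blast
  have "\<forall>i. \<exists>M Q. (\<forall>j. Q j \<in> alg_gen (cov_coords n) \<and> (\<forall>t x. Q j (?\<tau> t x) = t ^ j * Q j x)) \<and>
    (\<forall>j>M. Q j = (\<lambda>_. 0)) \<and> (\<forall>x. P i x = (\<Sum>j\<le>M. Q j x))"
    using alg_gen_graded[OF P(1), of ?\<tau>, OF g\<tau>] by blast
  then obtain M Q where Q: "\<And>i j. Q i j \<in> alg_gen (cov_coords n)"
    "\<And>i j t x. Q i j (?\<tau> t x) = t ^ j * Q i j x" "\<And>i x. P i x = (\<Sum>j\<le>M i. Q i j x)"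
    by metis
  define C where "C = (\<lambda>i j a. Q i j (a, (1, 1)))"
  have C: "C i j \<in> alg_gen ?A" for i j
    unfolding C_def using Q(1)
  proof (rule alg_gen_compose)
    fix g assume "g \<in> cov_coords n"
    then show "(\<lambda>x. g (x, 1, 1)) \<in> alg_gen ?A"
      by (rule cov_coords_cases) (auto intro: alg_gen.intros)
  qed
  define S where "S = (SIGMA i:{..N}. {..M i})"
  have fS: "finite S" by (simp add: S_def)
  have hS: "h (a, (u, v)) = (\<Sum>(i,j)\<in>S. C i j a * u ^ i * v ^ j)" for a u v
  proof -
    \<comment> \<open>\<open>Q i j\<close> is only known to scale in \<open>v\<close>, so
      \<open>u ^ i\<close> is first extracted from \<open>P i\<close>, and \<open>Q i j\<close> is
      used at \<open>u = 1\<close>.\<close>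
    have "P i (a, (u, v)) = u ^ i * (\<Sum>j\<le>M i. v ^ j * C i j a)" for i
      using P(2)[of i "(a, (1, v))" u] Q(2)[of i _ "(a, (1, 1))" v]
      by (simp add: Q(3)[of i "(a, (1, v))"] C_def)
    then show ?thesis
      by (simp add: P(3) S_def sum.Sigma[symmetric] sum_distrib_left algebra_simps)
  qed
  have hm: "h (a, (u, v)) = (\<Sum>(i,j)\<in>S. if i + j = m then C i j a * u ^ i * v ^ j else 0)" for a u v
  proof -
    \<comment> \<open>The restriction of \<open>h\<close> to the ray \<open>s * (u, v)\<close>, as a
      polynomial in \<open>s\<close>; by homogeneity it is the monomial of degree
      \<open>m\<close>.\<close>
    define q where "q = (\<Sum>(i,j)\<in>S. monom (C i j a * u ^ i * v ^ j) (i + j))"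
    have "poly q s = poly (monom (h (a, (u, v))) m) s" for s
    proof -
      have "poly q s = (\<Sum>(i,j)\<in>S. C i j a * (s * u) ^ i * (s * v) ^ j)"
        unfolding q_def poly_sum
        by (rule sum.cong) (auto simp: poly_monom power_add power_mult_distrib)
      then show ?thesis using hom[of a s u v] hS[of a "s * u" "s * v"] by (simp add: poly_monom)
    qed
    then have "q = monom (h (a, (u, v))) m" using poly_eq_poly_eq_iff by blast
    then have "h (a, (u, v)) = coeff q m" by simp
    also have "\<dots> = (\<Sum>(i,j)\<in>S. if i + j = m then C i j a * u ^ i * v ^ j else 0)"
      unfolding q_def coeff_sum by (rule sum.cong) auto
    finally show ?thesis .
  qed
  \<comment> \<open>The inverse binomial compensates the binomial factor in \<open>bf\<close>;
    monomials absent from the index set \<open>S\<close> get coefficient 0.\<close>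
  define c where "c = (\<lambda>a r. if (m - r, r) \<in> S then inverse (of_nat (m choose r)) * C (m - r) r a else 0)"
  have "(\<lambda>a. c a r) \<in> alg_gen ?A" for r
    by (cases "(m - r, r) \<in> S") (auto simp: c_def intro!: alg_gen_cmult C alg_gen.const)
  moreover have "h (a, (u, v)) = bf m (c a) (u, v)" for a u v
  proof -
    have "h (a, (u, v)) = (\<Sum>x\<in>{x\<in>S. fst x + snd x = m}. C (fst x) (snd x) a * u ^ fst x * v ^ snd x)"
      unfolding hm using fS by (simp add: sum.If_cases Int_def case_prod_beta)
    also have "\<dots> = (\<Sum>r\<in>{r\<in>{..m}. (m - r, r) \<in> S}. C (m - r) r a * u ^ (m - r) * v ^ r)"
      by (rule sum.reindex_bij_witness[of _ "\<lambda>r. (m - r, r)" snd]) auto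
    also have "\<dots> = bf m (c a) (u, v)"
      unfolding bf_Pair by (rule sum.mono_neutral_cong_left) (auto simp: c_def)
    finally show ?thesis .
  qed
  ultimately show ?thesis by (intro exI[of _ c]) auto
qed

section \<open>The action of SL(2) on coefficient vectors\<close>

lemma
  assumes "g \<in> sl2"
  shows gmap_ginv: "gmap g (ginv g \<xi>) = \<xi>" and ginv_gmap: "ginv g (gmap g \<xi>) = \<xi>"
proof -
  obtain p q r s where g: "g = (p, q, r, s)" by (cases g)
  obtain u v where \<xi>: "\<xi> = (u, v)" by (cases \<xi>)
  have det: "p * s - q * r = 1" using assms by (simp add: g sl2_def)
  have "p * (s * u - q * v) + q * (- r * u + p * v) = u"
    "r * (s * u - q * v) + s * (- r * u + p * v) = v"
    "s * (p * u + q * v) - q * (r * u + s * v) = u"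
    "- r * (p * u + q * v) + p * (r * u + s * v) = v"
    using det by algebra+
  then show "gmap g (ginv g \<xi>) = \<xi>" "ginv g (gmap g \<xi>) = \<xi>"
    by (simp_all add: g \<xi> gmap_def ginv_def)
qed

text \<open>Uniqueness for the description in \<open>act\<close>: the form fixes the entries up to
  \<open>m\<close>, and the entries above are normalised to 0.\<close>

lemma act_eqI:
  assumes "\<And>i. i > m \<Longrightarrow> c i = 0" "\<And>\<xi>. bf m c \<xi> = bf m a (ginv g \<xi>)"
  shows "act m g a = c"
  unfolding act_def
proof (rule the_equality)
  fix d assume d: "(\<forall>i>m. d i = 0) \<and> (\<forall>\<xi>. bf m d \<xi> = bf m a (ginv g \<xi>))"
  then have "d i = c i" if "i \<le> m" for i using bf_inj[of m d c i] assms(2) that by auto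
  then show "d = c" using d assms(1) by (metis ext linorder_not_less)
qed (use assms in auto)

text \<open>Existence for the description in \<open>act\<close>: a linear substitution keeps a form
  polynomial and homogeneous of degree \<open>m\<close>.\<close>

lemma bf_ginv_is_bf:
  obtains c where "\<And>i. i > m \<Longrightarrow> c i = 0" "\<And>\<xi>. bf m c \<xi> = bf m a (ginv g \<xi>)"
proof -
  obtain p q r s where g: "g = (p, q, r, s)" by (cases g)
  let ?h = "\<lambda>x. bf m (fst x) (ginv g (snd x))"
  have "?h = (\<lambda>x. \<Sum>i\<le>m. of_nat (m choose i) * fst x i * (s * fst (snd x) - q * snd (snd x)) ^ (m - i) *
      (- r * fst (snd x) + p * snd (snd x)) ^ i)"
    by (auto simp: g ginv_def bf_def case_prod_beta)
  \<comment> \<open>\<open>cov_coords m\<close> offers the coefficients up to \<open>2 * m\<close>,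
    which includes all indices up to \<open>m\<close>.\<close>
  also have "\<dots> \<in> alg_gen (cov_coords m)"
    by (intro alg_gen_sum alg_gen.mult alg_gen.const alg_gen_power alg_gen_diff alg_gen.add
        cov_coords_intros) auto
  finally have 1: "?h \<in> alg_gen (cov_coords m)" .
  have "ginv g (t * u, t * v) = (t * fst (ginv g (u, v)), t * snd (ginv g (u, v)))" for t u v
    by (simp add: g ginv_def algebra_simps)
  then have 2: "?h (a, (t * u, t * v)) = t ^ m * ?h (a, (u, v))" for t a u v
    by (simp add: bf_homogeneous)
  obtain c where c: "bf m a (ginv g \<xi>) = bf m (c a) \<xi>" for \<xi>
    using ex_bf_coefficients[OF 1 2] by auto
  show ?thesis
    by (rule that[of "\<lambda>i. if i \<le> m then c a i else 0"]) (auto simp: c cong: bf_cong)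
qed

lemma bf_act: "bf m (act m g a) \<xi> = bf m a (ginv g \<xi>)"
  and act_above: "i > m \<Longrightarrow> act m g a i = 0"
  by (rule bf_ginv_is_bf[of m a g]; use act_eqI in metis)+

lemma act_add: "act m g (\<lambda>i. a i + b i) = (\<lambda>i. act m g a i + act m g b i)"
  by (rule act_eqI) (auto simp: act_above bf_add bf_act)

lemma act_scale: "act m g (\<lambda>i. t * a i) = (\<lambda>i. t * act m g a i)"
  by (rule act_eqI) (auto simp: act_above bf_scale bf_act)

lemma act_cong:
  assumes "\<And>i. i \<le> m \<Longrightarrow> a i = b i"
  shows "act m g a = act m g b"
  using assms by (intro act_eqI) (auto simp: act_above bf_act intro: bf_cong)

lemma act_eq_on:
  assumes "\<And>\<xi>. bf m c \<xi> = bf m a (ginv g \<xi>)" "i \<le> m"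
  shows "act m g a i = c i"
  using bf_inj[of m "act m g a" c i] assms by (simp add: bf_act)

lemma act_zero: "act m g (\<lambda>_. 0) = (\<lambda>_. 0)"
  using act_scale[of m g 0 "\<lambda>_. 0"] by simp

lemma act_sum:
  "finite I \<Longrightarrow> act m g (\<lambda>i. \<Sum>j\<in>I. t j * e j i) = (\<lambda>i. \<Sum>j\<in>I. t j * act m g (e j) i)"
  by (induction I rule: finite_induct) (simp_all add: act_zero act_add act_scale)

section \<open>Powers of linear forms and the invariant pairing\<close>

text \<open>The coefficients of the \<open>m\<close>-th power of the linear form \<open>(x, y) \<mapsto> v x - u y\<close>
  vanishing at \<open>(u, v)\<close>.\<close>
definition power_form :: "nat \<Rightarrow> complex \<times> complex \<Rightarrow> nat \<Rightarrow> complex" where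
  "power_form m = (\<lambda>(u, v) i. if i \<le> m then v ^ (m - i) * (- u) ^ i else 0)"

lemma bf_power_form: "bf m (power_form m (u, v)) (x, y) = (v * x - u * y) ^ m"
proof -
  have "(v * x - u * y) ^ m = (\<Sum>i\<le>m. of_nat (m choose i) * (- u * y) ^ i * (v * x) ^ (m - i))"
    using binomial_ring[of "- u * y" "v * x" m] by simp
  also have "\<dots> = bf m (power_form m (u, v)) (x, y)"
    unfolding bf_Pair power_mult_distrib
    by (rule sum.cong) (auto simp: power_form_def)
  finally show ?thesis by simp
qed

text \<open>\<open>v x - u y\<close> is the symplectic form of the two points, and
  \<open>ginv g\<close> is the adjoint of \<open>gmap g\<close> for it.\<close>

lemma act_power_form:
  assumes "g \<in> sl2"
  shows "act m g (power_form m \<xi>) = power_form m (gmap g \<xi>)"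
proof (rule act_eqI)
  obtain p q r s where g: "g = (p, q, r, s)" by (cases g)
  fix \<eta> :: "complex \<times> complex"
  obtain u v x y where e: "\<xi> = (u, v)" "\<eta> = (x, y)" by (cases \<xi>; cases \<eta>)
  have "(r * u + s * v) * x - (p * u + q * v) * y = v * (s * x - q * y) - u * (- r * x + p * y)"
    by algebra
  then show "bf m (power_form m (gmap g \<xi>)) \<eta> = bf m (power_form m \<xi>) (ginv g \<eta>)"
    by (simp add: e g gmap_def ginv_def bf_power_form)
qed (auto simp: power_form_def split: prod.split)

text \<open>The transvectant of index \<open>m\<close> of two forms of degree \<open>m\<close>, in terms of coefficients.\<close>
definition pairing :: "nat \<Rightarrow> (nat \<Rightarrow> complex) \<Rightarrow> (nat \<Rightarrow> complex) \<Rightarrow> complex" where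
  "pairing m c d = (\<Sum>i\<le>m. (-1) ^ i * of_nat (m choose i) * c i * d (m - i))"

lemma pairing_cong:
  assumes "\<And>i. i \<le> m \<Longrightarrow> c i = c' i" "\<And>i. i \<le> m \<Longrightarrow> d i = d' i"
  shows "pairing m c d = pairing m c' d'"
  unfolding pairing_def using assms by (intro sum.cong) auto

lemma pairing_sum:
  "pairing m c (\<lambda>i. \<Sum>j\<in>I. t j * e j i) = (\<Sum>j\<in>I. t j * pairing m c (e j))"
  unfolding pairing_def sum_distrib_left
  by (subst (2) sum.swap) (simp add: algebra_simps)

text \<open>Reproducing property: pairing with a power of a linear form is evaluation at its zero.
  The sign disappears in the even degrees \<open>2 * k\<close> of \<open>varsigma\<close>.\<close>

lemma pairing_power_form: "pairing m c (power_form m (u, v)) = (-1) ^ m * bf m c (u, v)"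
  unfolding pairing_def bf_Pair sum_distrib_left
proof (rule sum.cong)
  fix i assume "i \<in> {..m}"
  then have "(-1) ^ i * (-1) ^ (m - i) = ((-1) ^ m :: complex)"
    by (simp add: power_add[symmetric])
  moreover have "(- u) ^ (m - i) = (-1) ^ (m - i) * u ^ (m - i)"
    by (rule power_minus)
  ultimately show "(-1) ^ i * of_nat (m choose i) * c i * power_form m (u, v) (m - i)
      = (-1) ^ m * (of_nat (m choose i) * c i * u ^ (m - i) * v ^ i)"
    using \<open>i \<in> {..m}\<close> by (simp add: power_form_def algebra_simps)
qed simp

text \<open>Both sides are linear in \<open>d\<close>, and a linear functional vanishing on all powers of linear
  forms is zero.\<close>
lemma pairing_act:
  assumes g: "g \<in> sl2"
  shows "pairing m (act m g c) (act m g d) = pairing m c d"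
proof -
  \<comment> \<open>\<open>e j\<close> are the standard basis vectors, and \<open>L j\<close> is the
    defect of invariance on \<open>e j\<close>.\<close>
  define e :: "nat \<Rightarrow> nat \<Rightarrow> complex" where "e = (\<lambda>j i. if i = j then 1 else 0)"
  define L where "L = (\<lambda>j. pairing m (act m g c) (act m g (e j)) - pairing m c (e j))"
  have expand: "pairing m (act m g c) (act m g d) - pairing m c d = (\<Sum>j\<le>m. d j * L j)" for d
  proof -
    let ?d = "\<lambda>i. \<Sum>j\<le>m. d j * e j i"
    have d: "d i = ?d i" if "i \<le> m" for i
      using that by (simp add: e_def if_distrib cong: if_cong)
    have "act m g d = act m g ?d" using d by (rule act_cong)
    moreover have "pairing m c d = pairing m c ?d" using d by (intro pairing_cong) auto
    ultimately show ?thesis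
      by (simp add: act_sum pairing_sum L_def algebra_simps sum_subtractf)
  qed
  \<comment> \<open>For the power form at \<open>(u, 1)\<close> both pairings evaluate
    \<open>c\<close> at \<open>(u, 1)\<close>, since \<open>g\<close> moves the point and the form
    together. The defect is a polynomial in \<open>u\<close> with coefficients \<open>L j\<close> up
    to sign.\<close>
  have "(\<Sum>j\<le>m. ((-1) ^ j * L j) * u ^ j) = 0" for u
  proof -
    have "pairing m (act m g c) (act m g (power_form m (u, 1))) = (-1) ^ m * bf m c (ginv g (gmap g (u, 1)))"
      unfolding act_power_form[OF g] by (cases "gmap g (u, 1)") (simp add: pairing_power_form bf_act)
    then have "(\<Sum>j\<le>m. power_form m (u, 1) j * L j) = 0"
      using expand[of "power_form m (u, 1)"] by (simp add: pairing_power_form ginv_gmap[OF g])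
    then show ?thesis
      by (simp add: power_form_def power_minus[of u] mult.assoc mult.left_commute mult.commute)
  qed
  then have "(-1) ^ j * L j = 0" if "j \<le> m" for j
    using polyfun_eq_0[of "\<lambda>j. (-1) ^ j * L j" m] that by blast
  then have "L j = 0" if "j \<le> m" for j using that by simp
  then show ?thesis using expand[of d] by simp
qed

section \<open>Partial derivatives and transvectants in coefficients\<close>

text \<open>By absorption of binomials, the derivative in \<open>u\<close> keeps the coefficients up
  to the degree as a factor; the derivative in \<open>v\<close> will in addition shift them by
  one.\<close>

lemma has_field_derivative_bf_fst:
  "((\<lambda>t. bf (Suc m) c (t, v)) has_field_derivative of_nat (Suc m) * bf m c (u, v)) (at u)"
proof -
  have "of_nat (Suc m) * bf m c (u, v) =
      (\<Sum>i\<le>Suc m. of_nat (Suc m choose i) * c i * (of_nat (Suc m - i) * u ^ (Suc m - i - 1)) * v ^ i)"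
  proof -
    have *: "of_nat (Suc m choose i) * of_nat (Suc m - i) = (of_nat (Suc m) * of_nat (m choose i) :: complex)"
      if "i \<le> m" for i
      using binomial_absorb_comp[of "Suc m" i] that
      by (metis diff_Suc_1 mult.commute of_nat_mult)
    have **: "of_nat (Suc m choose i) * c i * (of_nat (Suc m - i) * u ^ (Suc m - i - 1)) * v ^ i =
        of_nat (Suc m) * (of_nat (m choose i) * c i * u ^ (m - i) * v ^ i)" if "i \<le> m" for i
      using *[OF that] that
      by (simp add: Suc_diff_le del: of_nat_Suc binomial_Suc_Suc)
    have "(\<Sum>i\<le>m. of_nat (Suc m choose i) * c i * (of_nat (Suc m - i) * u ^ (Suc m - i - 1)) * v ^ i) =
        of_nat (Suc m) * bf m c (u, v)"
      unfolding bf_Pair sum_distrib_left by (rule sum.cong) (simp_all only: ** atMost_iff)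
    then show ?thesis by simp
  qed
  then show ?thesis
    unfolding bf_Pair
    by (simp only:) (intro DERIV_sum DERIV_cmult DERIV_cmult_right, auto intro!: derivative_eq_intros)
qed

lemma has_field_derivative_bf_snd:
  "((\<lambda>t. bf (Suc m) c (u, t)) has_field_derivative of_nat (Suc m) * bf m (\<lambda>i. c (Suc i)) (u, v)) (at v)"
proof -
  have "of_nat (Suc m) * bf m (\<lambda>i. c (Suc i)) (u, v) =
      (\<Sum>i\<le>Suc m. of_nat (Suc m choose i) * c i * u ^ (Suc m - i) * (of_nat i * v ^ (i - 1)))"
  proof -
    have *: "of_nat (Suc m choose Suc i) * of_nat (Suc i) = (of_nat (Suc m) * of_nat (m choose i) :: complex)" for i
      by (metis binomial_absorption diff_Suc_1 mult.commute of_nat_mult)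
    have **: "of_nat (Suc m choose Suc i) * c (Suc i) * u ^ (m - i) * (of_nat (Suc i) * v ^ i) =
        of_nat (Suc m) * (of_nat (m choose i) * c (Suc i) * u ^ (m - i) * v ^ i)" for i
      using *[of i] by (simp add: algebra_simps del: of_nat_Suc binomial_Suc_Suc)
    show ?thesis
      unfolding sum.atMost_Suc_shift by (simp add: bf_Pair sum_distrib_left ** del: of_nat_Suc binomial_Suc_Suc)
  qed
  then show ?thesis
    unfolding bf_Pair
    by (simp only:) (intro DERIV_sum DERIV_cmult DERIV_cmult_right, auto intro!: derivative_eq_intros)
qed

lemma pu_bf: "pu (bf (Suc m) c) = bf m (\<lambda>i. of_nat (Suc m) * c i)"
  unfolding pu_def bf_scale by (auto simp: fun_eq_iff bf_scale DERIV_imp_deriv[OF has_field_derivative_bf_fst] simp del: of_nat_Suc)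

lemma pv_bf: "pv (bf (Suc m) c) = bf m (\<lambda>i. of_nat (Suc m) * c (Suc i))"
  unfolding pv_def by (auto simp: fun_eq_iff bf_scale DERIV_imp_deriv[OF has_field_derivative_bf_snd] simp del: of_nat_Suc)

lemma pu_iter_bf: "(pu ^^ k) (bf k c) \<xi> = fact k * c 0"
proof (induction k arbitrary: c)
  case 0
  show ?case by (cases \<xi>) (simp add: bf_Pair)
next
  case (Suc k)
  show ?case unfolding funpow_Suc_right o_def pu_bf by (simp add: Suc.IH algebra_simps)
qed

text \<open>The \<open>l\<close> shifts leave the single coefficient \<open>c l\<close>, and the
  successive degrees multiply to the factorial.\<close>

lemma pu_pv_iter_bf: "(pu ^^ k) ((pv ^^ l) (bf (k + l) c)) \<xi> = fact (k + l) * c l"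
proof (induction l arbitrary: c)
  case 0
  show ?case by (simp add: pu_iter_bf)
next
  case (Suc l)
  show ?case unfolding funpow_Suc_right o_def add_Suc_right pv_bf by (simp add: Suc.IH algebra_simps)
qed

text \<open>The prefactors \<open>1 / fact m\<close> cancel the factorials of the two full
  derivatives. The value does not depend on \<open>\<xi>\<close>, so evaluating at the origin in
  \<open>varsigma\<close> loses nothing.\<close>

lemma transv_bf: "transv m m m (bf m c) (bf m d) \<xi> = pairing m c d"
proof -
  have *: "(pu ^^ (m - i)) ((pv ^^ i) (bf m c)) \<xi> = fact m * c i"
    "(pu ^^ i) ((pv ^^ (m - i)) (bf m d)) \<xi> = fact m * d (m - i)" if "i \<le> m" for i
    using pu_pv_iter_bf[of "m - i" i c \<xi>] pu_pv_iter_bf[of i "m - i" d \<xi>] that by simp_all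
  show ?thesis
    unfolding transv_def pairing_def sum_distrib_left
    by (rule sum.cong) (auto simp: *)
qed

section \<open>The map varsigma on homogeneous covariants\<close>

lemma higher_deriv_monomial_at_0:
  "(deriv ^^ j) (\<lambda>s :: complex. c * s ^ m) 0 = (if j = m then fact m * c else 0)"
proof (induction j arbitrary: c m)
  case 0
  show ?case by simp
next
  case (Suc j)
  have *: "deriv (\<lambda>s :: complex. c * s ^ m) = (\<lambda>s. (c * of_nat m) * s ^ (m - 1))"
    by (rule ext, rule DERIV_imp_deriv) (auto intro!: derivative_eq_intros)
  show ?case
    unfolding funpow_Suc_right o_def * Suc.IH by (cases m) (simp_all add: algebra_simps)
qed

lemma comp_homogeneous:
  assumes "\<And>s a u v. h (a, (s * u, s * v)) = s ^ m * h (a, (u, v))"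
  shows "comp j h = (if j = m then h else (\<lambda>_. 0))"
  by (auto simp: comp_def assms fun_eq_iff higher_deriv_monomial_at_0 mult.commute[of _ "h _"])

text \<open>For nonzero \<open>h\<close> the index set of the sum in \<open>varsigma\<close> is
  exactly \<open>{k}\<close>.\<close>

lemma varsigma_homogeneous:
  assumes "\<And>s a u v. h (a, (s * u, s * v)) = s ^ (2 * k) * h (a, (u, v))" "h \<noteq> (\<lambda>_. 0)"
  shows "varsigma h (a, b) =
    transv (2 * k) (2 * k) (2 * k) (\<lambda>\<xi>. h (a, \<xi>)) (\<lambda>\<xi>. bf 2 b \<xi> ^ k) (0, 0)"
proof -
  have "comp (2 * l) h = (if l = k then h else (\<lambda>_. 0))" for l
    using comp_homogeneous[of h "2 * k" "2 * l"] assms(1) by auto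
  moreover from this have "{l. comp (2 * l) h \<noteq> (\<lambda>_. 0)} = {k}" using assms(2) by auto
  ultimately show ?thesis by (simp add: varsigma_def)
qed

text \<open>Coefficient vectors have entries above \<open>2 * n\<close>, which \<open>act\<close>
  sets to 0; polynomial functions do not see this change.\<close>

lemma cov_coords_depends:
  assumes "h \<in> alg_gen (cov_coords n)" "\<And>i. i \<le> 2 * n \<Longrightarrow> a i = b i"
  shows "h (a, \<xi>) = h (b, \<xi>)"
  using assms(1)
proof induction
  case (gen g)
  then show ?case by (rule cov_coords_cases) (auto simp: assms(2))
qed auto

text \<open>Minus the identity fixes every form of degree \<open>2 * n\<close> but multiplies a
  covariant of order \<open>m\<close> by \<open>(-1) ^ m\<close>.\<close>

lemma even_order:
  assumes "h \<in> Cov n" "\<And>s a u v. h (a, (s * u, s * v)) = s ^ m * h (a, (u, v))" "h \<noteq> (\<lambda>_. 0)"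
  shows "even m"
proof (rule ccontr)
  assume "odd m"
  let ?g = "(-1, 0, 0, -1) :: complex \<times> complex \<times> complex \<times> complex"
  have "h (a, (u, v)) = 0" for a u v
  proof -
    have "act (2 * n) ?g a i = a i" if "i \<le> 2 * n" for i
    proof (rule act_eq_on[OF _ that])
      fix \<xi> show "bf (2 * n) a \<xi> = bf (2 * n) a (ginv ?g \<xi>)"
        using bf_homogeneous[of "2 * n" a "-1"] by (cases \<xi>) (simp add: ginv_def)
    qed
    then have "h (act (2 * n) ?g a, gmap ?g (u, v)) = h (a, gmap ?g (u, v))"
      using assms(1) by (intro cov_coords_depends[of h n]) (auto simp: Cov_def)
    moreover have "?g \<in> sl2" by (simp add: sl2_def)
    ultimately have "h (a, (u, v)) = h (a, gmap ?g (u, v))" using assms(1) by (auto simp: Cov_def)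
    also have "\<dots> = - h (a, (u, v))" using assms(2)[of a "-1" u v] \<open>odd m\<close> by (simp add: gmap_def)
    finally show ?thesis by simp
  qed
  then show False using assms(3) by auto
qed

lemma inv_coords_cases:
  assumes "g \<in> inv_coords n"
  obtains i where "i \<le> 2 * n" "g = (\<lambda>x. fst x i)" | j where "j \<le> 2" "g = (\<lambda>x. snd x j)"
  using assms by (auto simp: inv_coords_def)

lemma inv_coords_intros:
  "i \<le> 2 * n \<Longrightarrow> (\<lambda>x. fst x i) \<in> alg_gen (inv_coords n)"
  "j \<le> 2 \<Longrightarrow> (\<lambda>x. snd x j) \<in> alg_gen (inv_coords n)"
  by (auto simp: inv_coords_def intro: alg_gen.gen)

lemma bf_2_power_coefficients:
  obtains d where "\<And>i. (\<lambda>b. d b i) \<in> alg_gen {\<lambda>b. b j | j. j \<le> 2}"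
    "\<And>b \<xi>. bf 2 b \<xi> ^ k = bf (2 * k) (d b) \<xi>"
proof -
  let ?h = "\<lambda>x. bf 2 (fst x) (snd x) ^ k"
  have "?h = (\<lambda>x. (\<Sum>i\<le>2. of_nat (2 choose i) * fst x i * fst (snd x) ^ (2 - i) * snd (snd x) ^ i) ^ k)"
    by (auto simp: bf_def case_prod_beta)
  \<comment> \<open>Quadratic forms are the case \<open>n = 1\<close>, with coefficients up to index
    \<open>2 * 1\<close>.\<close>
  also have "\<dots> \<in> alg_gen (cov_coords 1)"
    by (intro alg_gen_sum alg_gen.mult alg_gen.const alg_gen_power cov_coords_intros) auto
  finally have 1: "?h \<in> alg_gen (cov_coords 1)" .
  have "?h (a, (s * u, s * v)) = s ^ (2 * k) * ?h (a, (u, v))" for s a u v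
    by (simp add: bf_homogeneous power_mult_distrib power_mult)
  from ex_bf_coefficients[OF 1 this] that show ?thesis by auto
qed

text \<open>All four facts come from one formula: \<open>varsigma h (a, b)\<close> pairs the
  coefficients \<open>c a\<close> of \<open>h (a, _)\<close> with the coefficients
  \<open>d b\<close> of the \<open>k\<close>-th power of the quadratic form.\<close>

lemma
  assumes h: "h \<in> Cov n" and hom: "\<And>s a u v. h (a, (s * u, s * v)) = s ^ (2 * k) * h (a, (u, v))"
    and nz: "h \<noteq> (\<lambda>_. 0)"
  shows varsigma_in_Inv2: "varsigma h \<in> Inv2 n"
    and varsigma_square: "varsigma h (a, power_form 2 \<xi>) = h (a, \<xi>)"
    and varsigma_scale: "varsigma h (a, \<lambda>i. t * b i) = t ^ k * varsigma h (a, b)"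
    and varsigma_vanishes: "(\<And>\<xi>. h (a, \<xi>) = 0) \<Longrightarrow> varsigma h (a, b) = 0"
proof -
  have hp: "h \<in> alg_gen (cov_coords n)" using h by (simp add: Cov_def)
  obtain c where c: "\<And>i. (\<lambda>a. c a i) \<in> alg_gen {\<lambda>a. a i | i. i \<le> 2 * n}"
    and hc: "\<And>a \<xi>. h (a, \<xi>) = bf (2 * k) (c a) \<xi>"
    using ex_bf_coefficients[OF hp hom] by blast
  obtain d where d: "\<And>i. (\<lambda>b. d b i) \<in> alg_gen {\<lambda>b. b j | j. j \<le> 2}"
    and wd: "\<And>b \<xi>. bf 2 b \<xi> ^ k = bf (2 * k) (d b) \<xi>"
    using bf_2_power_coefficients by blast
  have eq: "varsigma h (a, b) = pairing (2 * k) (c a) (d b)" for a b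
    unfolding varsigma_homogeneous[of h, OF hom nz] hc wd by (simp add: transv_bf)
  have "(\<lambda>x. c (fst x) i) \<in> alg_gen (inv_coords n)" for i
    using c[of i] by (rule alg_gen_compose) (auto intro: inv_coords_intros)
  moreover have "(\<lambda>x. d (snd x) i) \<in> alg_gen (inv_coords n)" for i
    using d[of i] by (rule alg_gen_compose) (auto intro: inv_coords_intros)
  ultimately have "(\<lambda>x. pairing (2 * k) (c (fst x)) (d (snd x))) \<in> alg_gen (inv_coords n)"
    unfolding pairing_def by (intro alg_gen_sum alg_gen.mult alg_gen.const)
  moreover have "varsigma h = (\<lambda>x. pairing (2 * k) (c (fst x)) (d (snd x)))" by (auto simp: eq)
  ultimately have 1: "varsigma h \<in> alg_gen (inv_coords n)" by simp
  have "varsigma h (act (2 * n) g a, act 2 g b) = varsigma h (a, b)" if g: "g \<in> sl2" for g a b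
  proof -
    have "h (act (2 * n) g a, \<xi>) = h (a, ginv g \<xi>)" for \<xi>
    proof -
      have "h (act (2 * n) g a, gmap g (ginv g \<xi>)) = h (a, ginv g \<xi>)"
        using h g unfolding Cov_def by blast
      then show ?thesis by (simp add: gmap_ginv[OF g])
    qed
    \<comment> \<open>Covariance of \<open>h\<close> says that \<open>c\<close> is equivariant, and
      \<open>d\<close> is equivariant because powers commute with substitution; invariance of the
      pairing then finishes.\<close>
    then have "act (2 * k) g (c a) i = c (act (2 * n) g a) i" if "i \<le> 2 * k" for i
      using that by (intro act_eq_on) (auto simp: hc)
    moreover have "act (2 * k) g (d b) i = d (act 2 g b) i" if "i \<le> 2 * k" for i
      using that by (intro act_eq_on) (auto simp: wd[symmetric] bf_act)
    ultimately have "varsigma h (act (2 * n) g a, act 2 g b) =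
        pairing (2 * k) (act (2 * k) g (c a)) (act (2 * k) g (d b))"
      unfolding eq by (intro pairing_cong) auto
    then show ?thesis by (simp add: pairing_act[OF g] eq)
  qed
  with 1 show "varsigma h \<in> Inv2 n" by (auto simp: Inv2_def)
  show "varsigma h (a, power_form 2 \<xi>) = h (a, \<xi>)"
  proof -
    \<comment> \<open>The \<open>k\<close>-th power of a squared linear form is its
      \<open>2 * k\<close>-th power, so the reproducing property applies.\<close>
    have "d (power_form 2 \<xi>) i = power_form (2 * k) \<xi> i" if "i \<le> 2 * k" for i
    proof (rule bf_inj[OF _ that])
      fix \<eta> show "bf (2 * k) (d (power_form 2 \<xi>)) \<eta> = bf (2 * k) (power_form (2 * k) \<xi>) \<eta>"
        by (cases \<xi>; cases \<eta>) (simp add: wd[symmetric] bf_power_form power_mult)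
    qed
    then have "varsigma h (a, power_form 2 \<xi>) = pairing (2 * k) (c a) (power_form (2 * k) \<xi>)"
      unfolding eq by (intro pairing_cong) auto
    then show ?thesis by (cases \<xi>) (simp add: pairing_power_form hc)
  qed
  show "varsigma h (a, \<lambda>i. t * b i) = t ^ k * varsigma h (a, b)"
  proof -
    have "d (\<lambda>i. t * b i) i = t ^ k * d b i" if "i \<le> 2 * k" for i
    proof (rule bf_inj[of "2 * k" _ "\<lambda>i. t ^ k * d b i", OF _ that])
      fix \<eta> show "bf (2 * k) (d (\<lambda>i. t * b i)) \<eta> = bf (2 * k) (\<lambda>i. t ^ k * d b i) \<eta>"
        by (simp add: wd[symmetric] bf_scale power_mult_distrib)
    qed
    then have "varsigma h (a, \<lambda>i. t * b i) = pairing (2 * k) (c a) (\<lambda>i. t ^ k * d b i)"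
      unfolding eq by (intro pairing_cong) auto
    then show ?thesis by (simp add: eq pairing_def sum_distrib_left algebra_simps)
  qed
  show "varsigma h (a, b) = 0" if "\<And>\<xi>. h (a, \<xi>) = 0"
  proof -
    have "c a i = 0" if "i \<le> 2 * k" for i
      using that \<open>\<And>\<xi>. h (a, \<xi>) = 0\<close> bf_inj[of "2 * k" "c a" "\<lambda>_. 0" i] bf_scale[of "2 * k" 0 "\<lambda>_. 0"]
      by (simp add: hc)
    then show ?thesis unfolding eq pairing_def by (intro sum.neutral) auto
  qed
qed

section \<open>The discriminant and restriction to squares\<close>

text \<open>Up to the factor \<open>- 1 / 2\<close> the discriminant is the pairing of a quadratic
  form with itself, hence invariant.\<close>

lemma Delta_in_Inv2: "Delta \<in> Inv2 n"
proof -
  have 1: "Delta x = - pairing 2 (snd x) (snd x) / 2" for x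
    by (cases x) (simp add: Delta_def pairing_def numeral_2_eq_2 algebra_simps)
  have "(\<lambda>x. snd x 1 ^ 2 - snd x 0 * snd x 2) \<in> alg_gen (inv_coords n)"
    by (intro alg_gen_diff alg_gen_power alg_gen.mult inv_coords_intros) auto
  moreover have "Delta = (\<lambda>x. snd x 1 ^ 2 - snd x 0 * snd x 2)" by (auto simp: Delta_def)
  ultimately have "Delta \<in> alg_gen (inv_coords n)" by simp
  then show ?thesis by (simp add: Inv2_def 1 pairing_act)
qed

lemma Delta_square: "Delta (a, power_form 2 \<xi>) = 0"
  by (cases \<xi>) (simp add: Delta_def power_form_def power2_eq_square)

text \<open>The homomorphism \<open>\<rho>\<close> lands in covariants because
  \<open>power_form\<close> is equivariant.\<close>

lemma square_in_Cov:
  assumes "F \<in> Inv2 n"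
  shows "(\<lambda>x. F (fst x, power_form 2 (snd x))) \<in> Cov n"
proof -
  have "(\<lambda>x. F (fst x, power_form 2 (snd x))) \<in> alg_gen (cov_coords n)"
  proof (rule alg_gen_compose[where p = F])
    show "F \<in> alg_gen (inv_coords n)" using assms by (simp add: Inv2_def)
    fix g assume "g \<in> inv_coords n"
    then show "(\<lambda>x. g (fst x, power_form 2 (snd x))) \<in> alg_gen (cov_coords n)"
    proof (rule inv_coords_cases)
      fix j :: nat assume j: "j \<le> 2" "g = (\<lambda>x. snd x j)"
      have "(\<lambda>x. snd (snd x) ^ (2 - j) * (-1 * fst (snd x)) ^ j) \<in> alg_gen (cov_coords n)"
        by (intro alg_gen.mult alg_gen_power alg_gen.const cov_coords_intros)
      then show ?thesis using j by (simp add: power_form_def case_prod_beta)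
    qed (auto intro: cov_coords_intros)
  qed
  then show ?thesis using assms by (auto simp: Cov_def Inv2_def act_power_form[symmetric])
qed

lemma Inv2_algebra: "alg_gen (Inv2 n) \<subseteq> Inv2 n"
proof
  fix F assume "F \<in> alg_gen (Inv2 n)"
  then show "F \<in> Inv2 n"
    by induction (auto simp: Inv2_def intro: alg_gen.intros)
qed

lemma alg_gen_subset_Inv2: "G \<subseteq> Inv2 n \<Longrightarrow> alg_gen G \<subseteq> Inv2 n"
  using alg_gen_least[of G "Inv2 n"] Inv2_algebra alg_gen.gen by blast

section \<open>Divisibility by the discriminant\<close>

text \<open>Restriction to lines in the space of quadratic forms gives polynomials in one variable,
  where a nonzero factor can be cancelled even if it has zeros.\<close>

lemma poly_on_line:
  assumes "F \<in> alg_gen (inv_coords n)"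
  shows "\<exists>P. \<forall>t. F (a, \<lambda>i. b i + t * d i) = poly P t"
  using assms
proof induction
  case (gen g)
  then show ?case
  proof (rule inv_coords_cases)
    fix i assume "g = (\<lambda>x. fst x i)"
    then show ?thesis by (intro exI[of _ "[:a i:]"]) simp
  next
    fix j assume "g = (\<lambda>x. snd x j)"
    then show ?thesis by (intro exI[of _ "[:b j, d j:]"]) simp
  qed
next
  case (const c)
  show ?case by (intro exI[of _ "[:c:]"]) simp
next
  case (add p q)
  then show ?case by (metis poly_add)
next
  case (mult p q)
  then show ?case by (metis poly_mult)
qed

text \<open>Division with remainder in \<open>b 1\<close>, using that its square is
  \<open>Delta + b 0 * b 2\<close>. The dependence condition says that \<open>A\<close> and
  \<open>B\<close> are free of \<open>b 1\<close>.\<close>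

lemma ex_division_by_Delta:
  assumes "F \<in> alg_gen (inv_coords n)"
  shows "\<exists>Q A B. Q \<in> alg_gen (inv_coords n) \<and> A \<in> alg_gen (inv_coords n) \<and> B \<in> alg_gen (inv_coords n) \<and>
    (\<forall>a b b'. b 0 = b' 0 \<longrightarrow> b 2 = b' 2 \<longrightarrow> A (a, b) = A (a, b') \<and> B (a, b) = B (a, b')) \<and>
    (\<forall>x. F x = Delta x * Q x + A x * snd x 1 + B x)"
  using assms
proof induction
  case (gen g)
  show ?case
  proof (cases "g = (\<lambda>x. snd x 1)")
    case True
    show ?thesis
      by (rule exI[of _ "\<lambda>_. 0"], rule exI[of _ "\<lambda>_. 1"], rule exI[of _ "\<lambda>_. 0"])
         (use True in \<open>auto intro: alg_gen.const\<close>)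
  next
    case False
    have g: "g (a, b) = g (a, b')" if "b 0 = b' 0" "b 2 = b' 2" for a b b'
      using gen
    proof (rule inv_coords_cases)
      fix j :: nat assume j: "j \<le> 2" "g = (\<lambda>x. snd x j)"
      with False have "j \<noteq> 1" by auto
      with j(1) have "j = 0 \<or> j = 2" by linarith
      with j that show ?thesis by auto
    qed auto
    show ?thesis
      by (rule exI[of _ "\<lambda>_. 0"], rule exI[of _ "\<lambda>_. 0"], rule exI[of _ g],
          intro conjI allI impI g alg_gen.const alg_gen.gen gen) simp_all
  qed
next
  case (const c)
  show ?case
    by (rule exI[of _ "\<lambda>_. 0"], rule exI[of _ "\<lambda>_. 0"], rule exI[of _ "\<lambda>_. c"])
       (auto intro: alg_gen.const)
next
  case (add p q)
  from add.IH(1) obtain Q A B where 1: "Q \<in> alg_gen (inv_coords n)" "A \<in> alg_gen (inv_coords n)"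
    "B \<in> alg_gen (inv_coords n)" "\<forall>x. p x = Delta x * Q x + A x * snd x 1 + B x"
    "\<forall>a b b'. b 0 = b' 0 \<longrightarrow> b 2 = b' 2 \<longrightarrow> A (a, b) = A (a, b') \<and> B (a, b) = B (a, b')" by blast
  from add.IH(2) obtain Q' A' B' where 2: "Q' \<in> alg_gen (inv_coords n)" "A' \<in> alg_gen (inv_coords n)"
    "B' \<in> alg_gen (inv_coords n)" "\<forall>x. q x = Delta x * Q' x + A' x * snd x 1 + B' x"
    "\<forall>a b b'. b 0 = b' 0 \<longrightarrow> b 2 = b' 2 \<longrightarrow> A' (a, b) = A' (a, b') \<and> B' (a, b) = B' (a, b')" by blast
  have "A (a, b) + A' (a, b) = A (a, b') + A' (a, b') \<and> B (a, b) + B' (a, b) = B (a, b') + B' (a, b')"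
    if "b 0 = b' 0" "b 2 = b' 2" for a b b'
  proof -
    have "A (a, b) = A (a, b')" "B (a, b) = B (a, b')" "A' (a, b) = A' (a, b')" "B' (a, b) = B' (a, b')"
      using 1(5) 2(5) that by blast+
    then show ?thesis by simp
  qed
  moreover have "p x + q x = Delta x * (Q x + Q' x) + (A x + A' x) * snd x 1 + (B x + B' x)" for x
    unfolding 1(4)[rule_format] 2(4)[rule_format] by (simp only: ring_distribs ac_simps)
  moreover note alg_gen.add[OF 1(1) 2(1)] alg_gen.add[OF 1(2) 2(2)] alg_gen.add[OF 1(3) 2(3)]
  ultimately show ?case
    by - (rule exI[of _ "\<lambda>x. Q x + Q' x"], rule exI[of _ "\<lambda>x. A x + A' x"],
        rule exI[of _ "\<lambda>x. B x + B' x"], blast)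
next
  case (mult p q)
  from mult.IH(1) obtain Q A B where 1: "Q \<in> alg_gen (inv_coords n)" "A \<in> alg_gen (inv_coords n)"
    "B \<in> alg_gen (inv_coords n)" "\<forall>x. p x = Delta x * Q x + A x * snd x 1 + B x"
    "\<forall>a b b'. b 0 = b' 0 \<longrightarrow> b 2 = b' 2 \<longrightarrow> A (a, b) = A (a, b') \<and> B (a, b) = B (a, b')" by blast
  from mult.IH(2) obtain Q' A' B' where 2: "Q' \<in> alg_gen (inv_coords n)" "A' \<in> alg_gen (inv_coords n)"
    "B' \<in> alg_gen (inv_coords n)" "\<forall>x. q x = Delta x * Q' x + A' x * snd x 1 + B' x"
    "\<forall>a b b'. b 0 = b' 0 \<longrightarrow> b 2 = b' 2 \<longrightarrow> A' (a, b) = A' (a, b') \<and> B' (a, b) = B' (a, b')" by blast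
  \<comment> \<open>Obtained by multiplying out both decompositions and replacing the square of
    \<open>b 1\<close> in the term with \<open>A * A'\<close> by
    \<open>Delta + b 0 * b 2\<close>.\<close>
  let ?Q = "\<lambda>x. Q x * q x + (A x * snd x 1 + B x) * Q' x + A x * A' x"
  let ?A = "\<lambda>x. A x * B' x + A' x * B x"
  let ?B = "\<lambda>x. A x * A' x * (snd x 0 * snd x 2) + B x * B' x"
  have "?Q \<in> alg_gen (inv_coords n)"
    by (intro alg_gen.add alg_gen.mult 1 2 mult.hyps inv_coords_intros) simp
  moreover have "?A \<in> alg_gen (inv_coords n)" by (intro alg_gen.add alg_gen.mult 1 2)
  moreover have "?B \<in> alg_gen (inv_coords n)"
    by (intro alg_gen.add alg_gen.mult 1 2 inv_coords_intros) simp_all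
  moreover have "?A (a, b) = ?A (a, b') \<and> ?B (a, b) = ?B (a, b')" if "b 0 = b' 0" "b 2 = b' 2" for a b b'
  proof -
    have "A (a, b) = A (a, b')" "B (a, b) = B (a, b')" "A' (a, b) = A' (a, b')" "B' (a, b) = B' (a, b')"
      using 1(5) 2(5) that by blast+
    then show ?thesis using that by simp
  qed
  moreover have "p x * q x = Delta x * ?Q x + ?A x * snd x 1 + ?B x" for x
  proof -
    have s1: "snd x 1 * snd x 1 = Delta x + snd x 0 * snd x 2"
      by (simp add: Delta_def case_prod_beta power2_eq_square)
    have s2: "p x * q x = Delta x * (Q x * q x) + (A x * snd x 1 + B x) * q x"
      unfolding 1(4)[rule_format] by (simp only: ring_distribs ac_simps)
    have s3: "(A x * snd x 1 + B x) * q x = Delta x * ((A x * snd x 1 + B x) * Q' x) +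
        A x * A' x * (snd x 1 * snd x 1) + ?A x * snd x 1 + B x * B' x"
      unfolding 2(4)[rule_format] by (simp only: ring_distribs ac_simps)
    show ?thesis unfolding s2 s3 s1 by (simp only: ring_distribs ac_simps)
  qed
  ultimately show ?case by - (rule exI[of _ ?Q], rule exI[of _ ?A], rule exI[of _ ?B], blast)
qed

text \<open>The remainder \<open>A b\<^sub>1 + B\<close> of division by \<open>Delta\<close>, evaluated at \<open>b = (v\<^sup>2, -u v, u\<^sup>2)\<close> and at
  \<open>(v\<^sup>2, u v, u\<^sup>2)\<close>, yields \<open>A u v = 0\<close> and \<open>B = 0\<close>.\<close>
lemma Delta_dvd_if_vanishes_on_squares:
  assumes F: "F \<in> alg_gen (inv_coords n)" and van: "\<And>a \<xi>. F (a, power_form 2 \<xi>) = 0"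
  obtains Q where "Q \<in> alg_gen (inv_coords n)" "\<And>x. F x = Delta x * Q x"
proof -
  obtain Q A B where Q: "Q \<in> alg_gen (inv_coords n)" and A: "A \<in> alg_gen (inv_coords n)"
    and dep: "\<And>a b b'. b 0 = b' 0 \<Longrightarrow> b 2 = b' 2 \<Longrightarrow> A (a, b) = A (a, b') \<and> B (a, b) = B (a, b')"
    and eq: "\<And>x. F x = Delta x * Q x + A x * snd x 1 + B x"
    using ex_division_by_Delta[OF F] by blast
  have AB: "A (a, b) * (b 0 * b 2) = 0 \<and> B (a, b) = 0" for a b
  proof -
    \<comment> \<open>Any values of \<open>b 0\<close> and \<open>b 2\<close> are the outer
      coefficients of the squares at \<open>(u, v)\<close> and \<open>(- u, v)\<close>, whose middle
      coefficients have opposite signs.\<close>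
    define u v where "u = csqrt (b 2)" and "v = csqrt (b 0)"
    have sq: "u * u = b 2" "v * v = b 0" by (simp_all add: u_def v_def flip: power2_eq_square)
    have "A (a, power_form 2 (w, v)) = A (a, b)" "B (a, power_form 2 (w, v)) = B (a, b)"
      if "w = u \<or> w = - u" for w
      using dep[of "power_form 2 (w, v)" b a] that sq by (auto simp: power_form_def power2_eq_square)
    then have "A (a, b) * (- w * v) + B (a, b) = 0" if "w = u \<or> w = - u" for w
      using eq[of "(a, power_form 2 (w, v))"] that
      by (simp add: van Delta_square) (simp add: power_form_def mult.commute)
    from this[of u] this[of "- u"]
    have *: "A (a, b) * (- u * v) + B (a, b) = 0" "A (a, b) * (u * v) + B (a, b) = 0" by simp_all
    then have "2 * B (a, b) = 0" by algebra
    moreover from this * have "A (a, b) * ((u * u) * (v * v)) = 0" by algebra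
    ultimately show ?thesis by (simp add: sq mult.commute)
  qed
  have "A (a, b) = 0" for a b
  proof -
    \<comment> \<open>In the all-ones direction \<open>b 0 * b 2\<close> becomes a product of two
      monic linear polynomials, so it can be cancelled also where it vanishes.\<close>
    obtain P where P: "\<And>t. A (a, \<lambda>i. b i + t * 1) = poly P t"
      using poly_on_line[OF A, of a b "\<lambda>_. 1"] by auto
    have "poly (P * ([:b 0, 1:] * [:b 2, 1:])) t = poly 0 t" for t
    proof -
      have "poly ([:b 0, 1:] * [:b 2, 1:]) t = (b 0 + t * 1) * (b 2 + t * 1)" by (simp add: algebra_simps)
      then show ?thesis using AB[of a "\<lambda>i. b i + t * 1"] by (simp only: P poly_mult poly_0)
    qed
    then have "P * ([:b 0, 1:] * [:b 2, 1:]) = 0" using poly_eq_poly_eq_iff by blast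
    then have "P = 0" by (metis mult_eq_0_iff one_neq_zero pCons_eq_0_iff)
    then show ?thesis using P[of 0] by simp
  qed
  then have "F x = Delta x * Q x" for x using eq[of x] AB by (cases x) simp
  with Q that show ?thesis by blast
qed

text \<open>A quotient of invariants is invariant where \<open>Delta\<close> is nonzero; restriction
  to a line extends this to the zeros of \<open>Delta\<close>.\<close>

lemma Inv2_cancel_Delta:
  assumes "F \<in> Inv2 n" and Q: "Q \<in> alg_gen (inv_coords n)" and eq: "\<And>x. F x = Delta x * Q x"
  shows "Q \<in> Inv2 n"
proof -
  have "Q (act (2 * n) g a, act 2 g b) = Q (a, b)" if g: "g \<in> sl2" for g a b
  proof -
    \<comment> \<open>The \<open>b 1\<close> direction, along which \<open>Delta\<close> is a monic
      quadratic in \<open>t\<close>. As \<open>act\<close> is linear, it maps the line to a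
      line.\<close>
    define d :: "nat \<Rightarrow> complex" where "d = (\<lambda>i. if i = 1 then 1 else 0)"
    let ?a = "act (2 * n) g a"
    obtain P where P: "\<And>t. Q (a, \<lambda>i. b i + t * d i) = poly P t"
      using poly_on_line[OF Q] by blast
    obtain P' where P': "\<And>t. Q (?a, \<lambda>i. act 2 g b i + t * act 2 g d i) = poly P' t"
      using poly_on_line[OF Q] by blast
    have "poly ((P' - P) * ([:b 1, 1:] ^ 2 - [:b 0 * b 2:])) t = poly 0 t" for t
    proof -
      let ?b = "\<lambda>i. b i + t * d i"
      have "F (?a, act 2 g ?b) = F (a, ?b)" "Delta (?a, act 2 g ?b) = Delta (a, ?b)"
        using assms(1) Delta_in_Inv2[of n] g by (auto simp: Inv2_def)
      then have "(Q (?a, act 2 g ?b) - Q (a, ?b)) * Delta (a, ?b) = 0"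
        by (simp add: eq algebra_simps)
      moreover have "Delta (a, ?b) = poly ([:b 1, 1:] ^ 2 - [:b 0 * b 2:]) t"
        by (simp add: Delta_def d_def)
      ultimately show ?thesis by (simp only: P P' act_add act_scale poly_mult poly_diff poly_0)
    qed
    then have "(P' - P) * ([:b 1, 1:] ^ 2 - [:b 0 * b 2:]) = 0" using poly_eq_poly_eq_iff by blast
    moreover have "[:b 1, 1:] ^ 2 - [:b 0 * b 2:] \<noteq> 0"
      by (simp add: power2_eq_square)
    ultimately have "P' = P" by simp
    then show ?thesis using P[of 0] P'[of 0] by simp
  qed
  then show ?thesis using Q by (auto simp: Inv2_def)
qed

section \<open>Generation and minimality\<close>

lemma power_form_scale: "power_form m (s * u, s * v) i = s ^ m * power_form m (u, v) i"
proof (cases "i \<le> m")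
  case True
  have "(- (s * u)) ^ i = s ^ i * (- u) ^ i"
    by (subst power_mult_distrib[symmetric]) simp
  moreover have "s ^ (m - i) * s ^ i = s ^ m" using True by (simp flip: power_add)
  ultimately show ?thesis
    using True by (simp add: power_form_def power_mult_distrib[of s v] ac_simps)
qed (simp add: power_form_def)

text \<open>Squares are stable under scaling since scalars have square roots; so degrees in
  \<open>b\<close> can be compared on squares alone.\<close>

lemma scale_power_form_2: "(\<lambda>i. t * power_form 2 (u, v) i) = power_form 2 (csqrt t * u, csqrt t * v)"
  by (simp add: fun_eq_iff power_form_scale)

lemma inv_coords_homogeneous:
  assumes "g \<in> inv_coords n"
  shows "\<exists>d. \<forall>t x. g (fst x, \<lambda>i. t * snd x i) = t ^ d * g x"
  using assms by (rule inv_coords_cases) (auto intro: exI[of _ "0::nat"] exI[of _ "1::nat"])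

text \<open>The action commutes with scaling of \<open>b\<close>, so comparing powers of
  \<open>t\<close> makes each graded component invariant.\<close>

lemma Inv2_homogeneous_components:
  assumes "F \<in> Inv2 n"
  obtains N P where "\<And>j. P j \<in> Inv2 n" "\<And>j t a b. P j (a, \<lambda>i. t * b i) = t ^ j * P j (a, b)"
    "F = (\<lambda>x. \<Sum>j\<le>N. P j x)"
proof -
  have F: "F \<in> alg_gen (inv_coords n)" using assms by (simp add: Inv2_def)
  obtain N P where P: "\<And>j. P j \<in> alg_gen (inv_coords n)"
    "\<And>j t x. P j (fst x, \<lambda>i. t * snd x i) = t ^ j * P j x"
    "\<And>j. j > N \<Longrightarrow> P j = (\<lambda>_. 0)" "\<And>x. F x = (\<Sum>j\<le>N. P j x)"
    using alg_gen_graded[OF F, of "\<lambda>t x. (fst x, \<lambda>i. t * snd x i)", OF inv_coords_homogeneous[of _ n]] by blast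
  have hom: "P j (a, \<lambda>i. t * b i) = t ^ j * P j (a, b)" for j t a b
    using P(2)[of j "(a, b)" t] by simp
  have "P j (act (2 * n) g a, act 2 g b) = P j (a, b)" if g: "g \<in> sl2" for j g a b
  proof (cases "j \<le> N")
    case True
    have "(\<Sum>j\<le>N. P j (act (2 * n) g a, act 2 g b) * t ^ j) = (\<Sum>j\<le>N. P j (a, b) * t ^ j)" for t
    proof -
      have "F (act (2 * n) g a, act 2 g (\<lambda>i. t * b i)) = F (a, \<lambda>i. t * b i)"
        using assms g unfolding Inv2_def by blast
      then show ?thesis by (simp add: P(4) act_scale hom mult.commute)
    qed
    then show ?thesis
      using True polyfun_eq_coeffs[of "\<lambda>j. P j (act (2 * n) g a, act 2 g b)" N "\<lambda>j. P j (a, b)"] by blast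
  qed (simp add: P(3))
  then have "P j \<in> Inv2 n" for j using P(1) by (auto simp: Inv2_def)
  moreover have "F = (\<lambda>x. \<Sum>j\<le>N. P j x)" using P(4) by auto
  ultimately show ?thesis using hom that by blast
qed

lemma Inv2_diff:
  assumes "F \<in> Inv2 n" "G \<in> Inv2 n"
  shows "(\<lambda>x. F x - G x) \<in> Inv2 n"
  using assms by (auto simp: Inv2_def intro: alg_gen_diff)

text \<open>The quotient need not be known to be homogeneous: its component of degree
  \<open>d - 2\<close> already gives \<open>F\<close>. The bound \<open>d \<ge> 2\<close> makes the
  degree drop strictly in the later induction.\<close>

lemma Delta_quotient_homogeneous:
  assumes F: "F \<in> Inv2 n" and hom: "\<And>t a b. F (a, \<lambda>i. t * b i) = t ^ d * F (a, b)"
    and van: "\<And>a \<xi>. F (a, power_form 2 \<xi>) = 0" and nz: "F \<noteq> (\<lambda>_. 0)"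
  obtains Q where "Q \<in> Inv2 n" "\<And>t a b. Q (a, \<lambda>i. t * b i) = t ^ (d - 2) * Q (a, b)"
    "d \<ge> 2" "F = (\<lambda>x. Delta x * Q x)"
proof -
  have "F \<in> alg_gen (inv_coords n)" using F by (simp add: Inv2_def)
  then obtain Q where Q: "Q \<in> alg_gen (inv_coords n)" "\<And>x. F x = Delta x * Q x"
    using Delta_dvd_if_vanishes_on_squares[of F n, OF _ van] by blast
  have "Q \<in> Inv2 n" using Inv2_cancel_Delta[OF F Q] .
  then obtain N P where P: "\<And>j. P j \<in> Inv2 n" "\<And>j t a b. P j (a, \<lambda>i. t * b i) = t ^ j * P j (a, b)"
    "Q = (\<lambda>x. \<Sum>j\<le>N. P j x)" using Inv2_homogeneous_components by blast
  \<comment> \<open>The graded components of \<open>Delta * Q\<close>, two degrees above those of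
    \<open>Q\<close>.\<close>
  define R where "R = (\<lambda>x j. if j \<ge> 2 \<and> j \<le> Suc (Suc N) then Delta x * P (j - 2) x else 0)"
  have FR: "F x = R x d" for x
  proof (rule homogeneous_component_eq)
    obtain a b where x: "x = (a, b)" by (cases x)
    have Dt: "Delta (a, \<lambda>i. t * b i) = t * (t * Delta (a, b))" for t
      by (simp add: Delta_def algebra_simps power2_eq_square)
    have "(\<Sum>j\<le>Suc (Suc N). t ^ j * R x j) = (\<Sum>j\<le>N. t ^ (Suc (Suc j)) * (Delta x * P j x))" for t
      unfolding sum.atMost_Suc_shift by (simp add: R_def)
    moreover have "t ^ d * F x = (\<Sum>j\<le>N. t ^ (Suc (Suc j)) * (Delta x * P j x))" for t
    proof -
      have "t ^ d * F x = F (a, \<lambda>i. t * b i)" by (simp add: x hom)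
      also have "\<dots> = (\<Sum>j\<le>N. t ^ (Suc (Suc j)) * (Delta x * P j x))"
        unfolding Q(2) P(3) Dt x by (simp add: P(2) sum_distrib_left algebra_simps)
      finally show ?thesis .
    qed
    ultimately show "t ^ d * F x = (\<Sum>j\<le>Suc (Suc N). t ^ j * R x j)" for t by simp
  qed (simp add: R_def)
  with nz have d: "d \<ge> 2" "d \<le> Suc (Suc N)" by (auto simp: R_def fun_eq_iff split: if_splits)
  show ?thesis
    by (rule that[of "P (d - 2)"]) (use P d FR in \<open>auto simp: R_def\<close>)
qed

section \<open>Constant covariants\<close>

text \<open>Taking \<open>t = 0\<close> removes the dependence on the form, leaving an
  SL(2)-invariant homogeneous function of \<open>\<xi>\<close>. Since SL(2) is transitive on nonzero
  vectors, positive order forces it to be 0.\<close>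

lemma Cov_degree_0_const:
  assumes h: "h \<in> Cov n" and hom: "\<And>t s a u v. h (\<lambda>i. t * a i, (s * u, s * v)) = s ^ k * h (a, (u, v))"
  shows "\<exists>c. h = (\<lambda>_. c)"
proof (cases "k = 0")
  case True
  have "h (a, (u, v)) = h (\<lambda>i. 0, (0, 0))" for a u v
    using hom[of 0 a 0 u v] True by simp
  then show ?thesis by (intro exI[of _ "h (\<lambda>i. 0, (0, 0))"]) (auto simp: fun_eq_iff)
next
  case False
  let ?f = "\<lambda>\<xi>. h (\<lambda>_. 0, \<xi>)"
  have inv: "?f (gmap g \<xi>) = ?f \<xi>" if "g \<in> sl2" for g \<xi>
    using h that act_zero[of "2 * n" g] unfolding Cov_def by (metis (mono_tags, lifting) mem_Collect_eq)
  \<comment> \<open>This diagonal matrix doubles \<open>(1, 0)\<close>, so invariance and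
    homogeneity of order \<open>k\<close> clash unless the value is 0.\<close>
  have "?f (1, 0) = ?f (gmap (2, 0, 0, 1/2) (1, 0))"
    by (rule inv[symmetric]) (simp add: sl2_def)
  also have "\<dots> = 2 ^ k * ?f (1, 0)"
    using hom[of 0 "\<lambda>_. 0" 2 1 0] by (simp add: gmap_def)
  finally have "(2 ^ k - 1) * ?f (1, 0) = 0" by (simp add: algebra_simps)
  moreover have "(2 :: complex) ^ k \<noteq> 1"
  proof
    assume "(2 :: complex) ^ k = 1"
    then have "norm ((2 :: complex) ^ k) = 1" by simp
    then have "(2 :: real) ^ k = 1" by (simp add: norm_power)
    then show False using False one_less_power[of "2 :: real" k] by simp
  qed
  ultimately have 0: "?f (1, 0) = 0" by simp
  have "?f (u, v) = 0" for u v
  proof -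
    \<comment> \<open>In the first two cases a matrix with first column \<open>(u, v)\<close>
      carries \<open>(1, 0)\<close> to \<open>(u, v)\<close>.\<close>
    consider "u \<noteq> 0" | "u = 0" "v \<noteq> 0" | "u = 0" "v = 0" by blast
    then show ?thesis
    proof cases
      case 1
      then show ?thesis using inv[of "(u, 0, v, 1 / u)" "(1, 0)"] 0 by (simp add: gmap_def sl2_def)
    next
      case 2
      then show ?thesis using inv[of "(0, - 1 / v, v, 0)" "(1, 0)"] 0 by (simp add: gmap_def sl2_def)
    next
      case 3
      then show ?thesis using hom[of 0 "\<lambda>_. 0" 0 0 0] False by (simp add: power_0_left)
    qed
  qed
  moreover have "h (a, (u, v)) = ?f (u, v)" for a u v
    using hom[of 0 a 1 u v] by simp
  ultimately show ?thesis by (intro exI[of _ 0]) (auto simp: fun_eq_iff)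
qed

text \<open>Constants belong to every generated algebra, so a constant generator could be
  dropped.\<close>

lemma min_gen_not_const:
  assumes "min_gen A G" "g \<in> G"
  shows "g \<noteq> (\<lambda>_. c)"
proof
  assume "g = (\<lambda>_. c)"
  then have "alg_gen (G - {g}) = A"
    using assms alg_gen_insert_const[of c "G - {g}"] by (auto simp: min_gen_def insert_absorb)
  moreover have "G - {g} \<subset> G" using assms(2) by blast
  ultimately show False using assms(1) unfolding min_gen_def by blast
qed

theorem theoremA6:
  fixes n :: nat
    and H :: "((nat \<Rightarrow> complex) \<times> (complex \<times> complex) \<Rightarrow> complex) set"
  assumes "finite H"
    and "min_gen (Cov n) H"
    and "\<forall>h\<in>H. homog_cov h"
  shows "min_gen (Inv2 n) (insert Delta (varsigma ` H))"
proof -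
  let ?V = "varsigma ` H"
  have gen: "alg_gen H = Cov n" using assms(2) by (simp add: min_gen_def)
  have H: "varsigma h \<in> Inv2 n \<and> (\<forall>a \<xi>. varsigma h (a, power_form 2 \<xi>) = h (a, \<xi>)) \<and>
      (\<exists>k. \<forall>t a b. varsigma h (a, \<lambda>i. t * b i) = t ^ k * varsigma h (a, b)) \<and>
      (\<forall>b. varsigma h (\<lambda>_. 0, b) = 0)" if h: "h \<in> H" for h
  proof -
    have hC: "h \<in> Cov n" using gen h alg_gen.gen by blast
    have nz: "h \<noteq> (\<lambda>_. 0)" using min_gen_not_const[OF assms(2) h] .
    obtain d m where dm: "\<And>t s a u v. h (\<lambda>i. t * a i, (s * u, s * v)) = t ^ d * s ^ m * h (a, (u, v))"
      using assms(3) h unfolding homog_cov_def by blast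
    have m: "h (a, (s * u, s * v)) = s ^ m * h (a, (u, v))" for s a u v
      using dm[of 1 a s u v] by simp
    obtain k where "m = 2 * k" using even_order[OF hC m nz] by (rule evenE)
    with m have k: "h (a, (s * u, s * v)) = s ^ (2 * k) * h (a, (u, v))" for s a u v by simp
    \<comment> \<open>Positive degree in the form makes \<open>h\<close>, and with it
      \<open>varsigma h\<close>, vanish at the zero form; this is what singles out
      \<open>Delta\<close> below.\<close>
    have "d \<noteq> 0"
    proof
      assume "d = 0"
      then have "\<exists>c. h = (\<lambda>_. c)" using dm by (intro Cov_degree_0_const[OF hC, of m]) simp
      then show False using min_gen_not_const[OF assms(2) h] by blast
    qed
    then have "h (\<lambda>_. 0, \<xi>) = 0" for \<xi>
      using dm[of 0 "\<lambda>_. 0" 1 "fst \<xi>" "snd \<xi>"] by (simp add: power_0_left)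
    then show ?thesis
      using varsigma_in_Inv2[OF hC k nz] varsigma_square[OF hC k nz] varsigma_scale[OF hC k nz]
        varsigma_vanishes[OF hC k nz] by blast
  qed
  have V: "?V \<subseteq> Inv2 n" using H by blast
  \<comment> \<open>Replacing each generator \<open>h\<close> by \<open>varsigma h\<close> in a
    polynomial expression gives a preimage under \<open>\<rho>\<close>.\<close>
  have lift: "\<exists>P\<in>alg_gen ?V. \<forall>a \<xi>. P (a, power_form 2 \<xi>) = h (a, \<xi>)" if "h \<in> Cov n" for h
    using that unfolding gen[symmetric]
  proof induction
    case (gen h)
    then show ?case using H by (intro bexI[of _ "varsigma h"]) (auto intro: alg_gen.gen)
  next
    case (const c)
    show ?case by (intro bexI[of _ "\<lambda>_. c"]) (auto intro: alg_gen.const)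
  next
    case (add p q)
    then obtain P Q where "P \<in> alg_gen ?V" "Q \<in> alg_gen ?V" "\<forall>a \<xi>. P (a, power_form 2 \<xi>) = p (a, \<xi>)"
      "\<forall>a \<xi>. Q (a, power_form 2 \<xi>) = q (a, \<xi>)" by blast
    then show ?case by (intro bexI[of _ "\<lambda>x. P x + Q x"]) (auto intro: alg_gen.add)
  next
    case (mult p q)
    then obtain P Q where "P \<in> alg_gen ?V" "Q \<in> alg_gen ?V" "\<forall>a \<xi>. P (a, power_form 2 \<xi>) = p (a, \<xi>)"
      "\<forall>a \<xi>. Q (a, power_form 2 \<xi>) = q (a, \<xi>)" by blast
    then show ?case by (intro bexI[of _ "\<lambda>x. P x * Q x"]) (auto intro: alg_gen.mult)
  qed
  let ?S = "alg_gen (insert Delta ?V)"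
  have VS: "alg_gen ?V \<subseteq> ?S" by (rule alg_gen_least) (auto intro: alg_gen.gen)
  \<comment> \<open>Strong induction on the degree \<open>d\<close> in the quadratic form: subtract
    a lift of the restriction of \<open>F\<close> to squares, then divide by
    \<open>Delta\<close>.\<close>
  have homS: "F \<in> ?S" if "F \<in> Inv2 n" "\<And>t a b. F (a, \<lambda>i. t * b i) = t ^ d * F (a, b)" for F d
    using that
  proof (induction d arbitrary: F rule: less_induct)
    case (less d)
    obtain P where P: "P \<in> alg_gen ?V" "\<And>a \<xi>. P (a, power_form 2 \<xi>) = F (a, power_form 2 \<xi>)"
      using lift[OF square_in_Cov[OF less.prems(1)]] by auto
    have "\<exists>d. \<forall>t x. g (fst x, \<lambda>i. t * snd x i) = t ^ d * g x" if "g \<in> ?V" for g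
      using H that by auto
    from alg_gen_graded[OF P(1), of "\<lambda>t x. (fst x, \<lambda>i. t * snd x i)", OF this]
    obtain N R where R: "\<And>j. R j \<in> alg_gen ?V" "\<And>j t x. R j (fst x, \<lambda>i. t * snd x i) = t ^ j * R j x"
      "\<And>j. j > N \<Longrightarrow> R j = (\<lambda>_. 0)" "\<And>x. P x = (\<Sum>j\<le>N. R j x)" by blast
    have Rs: "R j (a, \<lambda>i. t * b i) = t ^ j * R j (a, b)" for j t a b
      using R(2)[of j "(a, b)" t] by simp
    \<comment> \<open>\<open>P\<close> agrees with \<open>F\<close> on squares, a set stable under
      scaling, so there its component of degree \<open>d\<close> alone agrees with
      \<open>F\<close>.\<close>
    have FR: "F (a, power_form 2 \<xi>) = R d (a, power_form 2 \<xi>)" for a \<xi>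
    proof (rule homogeneous_component_eq[where d = d and N = N and P = "\<lambda>j. R j (a, power_form 2 \<xi>)"])
      fix t
      obtain u v where \<xi>: "\<xi> = (u, v)" by (cases \<xi>)
      have "t ^ d * F (a, power_form 2 \<xi>) = F (a, \<lambda>i. t * power_form 2 \<xi> i)"
        by (simp add: less.prems(2))
      also have "\<dots> = P (a, \<lambda>i. t * power_form 2 \<xi> i)"
        by (simp add: \<xi> scale_power_form_2 P(2))
      finally show "t ^ d * F (a, power_form 2 \<xi>) = (\<Sum>j\<le>N. t ^ j * R j (a, power_form 2 \<xi>))"
        by (simp add: R(4) Rs)
    qed (simp add: R(3))
    define F' where "F' = (\<lambda>x. F x - R d x)"
    have F': "F' \<in> Inv2 n" unfolding F'_def
      using less.prems(1) R(1) alg_gen_subset_Inv2[OF V] by (blast intro: Inv2_diff)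
    have F'h: "F' (a, \<lambda>i. t * b i) = t ^ d * F' (a, b)" for t a b
      by (simp add: F'_def less.prems(2) Rs algebra_simps)
    have F'v: "F' (a, power_form 2 \<xi>) = 0" for a \<xi> by (simp add: F'_def FR)
    have "F' \<in> ?S"
    proof (cases "F' = (\<lambda>_. 0)")
      case True
      then show ?thesis by (simp add: alg_gen.const)
    next
      case False
      obtain Q where Q: "Q \<in> Inv2 n" "\<And>t a b. Q (a, \<lambda>i. t * b i) = t ^ (d - 2) * Q (a, b)"
        "d \<ge> 2" "F' = (\<lambda>x. Delta x * Q x)"
        using Delta_quotient_homogeneous[OF F' F'h F'v False] by blast
      have "Q \<in> ?S" using less.IH[of "d - 2" Q] Q by simp
      then show ?thesis unfolding Q(4) by (intro alg_gen.mult alg_gen.gen[of Delta]) auto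
    qed
    moreover have "R d \<in> ?S" using R(1) VS by blast
    ultimately have "(\<lambda>x. F' x + R d x) \<in> ?S" by (rule alg_gen.add)
    then show ?case by (simp add: F'_def)
  qed
  have "Inv2 n \<subseteq> ?S"
  proof
    fix F assume "F \<in> Inv2 n"
    then obtain N P where P: "\<And>j. P j \<in> Inv2 n" "\<And>j t a b. P j (a, \<lambda>i. t * b i) = t ^ j * P j (a, b)"
      "F = (\<lambda>x. \<Sum>j\<le>N. P j x)" by (rule Inv2_homogeneous_components) blast
    show "F \<in> ?S" unfolding P(3) by (intro alg_gen_sum homS[OF P(1,2)])
  qed
  moreover have "?S \<subseteq> Inv2 n" using V Delta_in_Inv2 by (intro alg_gen_subset_Inv2) auto
  ultimately have eq: "?S = Inv2 n" by blast
  have "alg_gen G' \<noteq> Inv2 n" if G': "G' \<subset> insert Delta ?V" for G'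
  proof
    assume G'gen: "alg_gen G' = Inv2 n"
    show False
    proof (cases "Delta \<in> G'")
      case False
      \<comment> \<open>Without \<open>Delta\<close> every generator vanishes at the zero form, so
        everything generated is constant there, whereas \<open>Delta\<close> takes the values 0 and
        1.\<close>
      have "\<exists>c. \<forall>b. p (\<lambda>_. 0, b) = c" if "p \<in> alg_gen G'" for p
        using that
      proof induction
        case (gen g)
        with G' False have "g \<in> ?V" by blast
        then show ?case using H by auto
      next
        case (add p q)
        then show ?case by metis
      next
        case (mult p q)
        then show ?case by metis
      qed auto
      moreover have "Delta \<in> alg_gen G'" using Delta_in_Inv2 G'gen by simp
      ultimately obtain c where "\<And>b. Delta (\<lambda>_. 0, b) = c" by blast
      from this[of "\<lambda>_. 0"] this[of "\<lambda>i. if i = 1 then 1 else 0"] show False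
        by (simp add: Delta_def)
    next
      case True
      \<comment> \<open>Since \<open>Delta\<close> is in \<open>G'\<close>, the missing generator is
        some \<open>varsigma h\<close>, and that \<open>h\<close> is not in
        \<open>H'\<close>.\<close>
      define H' where "H' = {h \<in> H. varsigma h \<in> G'}"
      have "H' \<subset> H" using G' True by (auto simp: H'_def)
      moreover have "Cov n \<subseteq> alg_gen H'"
      proof
        fix h assume "h \<in> Cov n"
        then obtain P where P: "P \<in> alg_gen ?V" "\<And>a \<xi>. P (a, power_form 2 \<xi>) = h (a, \<xi>)"
          using lift by blast
        have "P \<in> alg_gen G'" using P(1) alg_gen_subset_Inv2[OF V] G'gen by blast
        \<comment> \<open>Applying \<open>\<rho>\<close> to an expression in \<open>G'\<close> sends
          \<open>Delta\<close> to 0 and each other generator to an element of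
          \<open>H'\<close>.\<close>
        then have "(\<lambda>x. P (fst x, power_form 2 (snd x))) \<in> alg_gen H'"
        proof (rule alg_gen_compose)
          fix g assume g: "g \<in> G'"
          show "(\<lambda>x. g (fst x, power_form 2 (snd x))) \<in> alg_gen H'"
          proof (cases "g = Delta")
            case True
            then show ?thesis by (simp add: Delta_square alg_gen.const)
          next
            case False
            with g G' obtain h where h: "h \<in> H" "g = varsigma h" by blast
            then have "(\<lambda>x. g (fst x, power_form 2 (snd x))) = h" using H by auto
            then show ?thesis using h g by (auto simp: H'_def intro: alg_gen.gen)
          qed
        qed
        then show "h \<in> alg_gen H'" by (simp add: P(2))
      qed
      moreover have "alg_gen H' \<subseteq> alg_gen H" by (rule alg_gen_least) (auto simp: H'_def intro: alg_gen.gen)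
      ultimately show False using assms(2) gen unfolding min_gen_def by blast
    qed
  qed
  with eq show ?thesis unfolding min_gen_def by blast
qed

end
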